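(* Let $\alpha\in(0,1)$ and let $\widehat{\mathrm{CI}}^{\mathtt{GHulC}}_{N,\alpha}$ be the GHulC confidence interval (described in the context) using $B$ splits of approximately equal size. Let $\widehat\theta^m$ be an estimator of $\theta_0$ based on a sample of size $m$ and let $r_m$ be its rate of convergence, i.e. $r_m(\widehat\theta^m-\theta_0)=O_p(1)$ as $m\to\infty$. Let $\widetilde F_{N/B}$ be the distribution function of $r_{N/B}(\widehat\theta_j^{N/B}-\theta_0)$, where $\widehat\theta_j^{N/B}$ is the estimator computed on the $j$-th split (of size approximately $N/B$), and assume $$\left|\widetilde F_{N/B}(t)-\widetilde F_{N/B}(0)-M_N|t|^\rho\,\mathrm{sgn}(t)\right|\le C_N|t|^{\rho+\Delta}\quad\text{for all } |t|<\eta,$$ where $0<M_N,C_N,\Delta,\eta,\rho<\infty$. Let $|\widetilde F_{N/B}(0)-1/2|\le\mathcal{E}_B$ and $B\mathcal{E}_B\to0$ as $N\to\infty$. Then, as $N/B\to\infty$ and $B\to\infty$, $$B^{1/(2\rho)}\,r_{N/B}\,M_N^{1/\rho}\,\mathrm{Width}\left(\widehat{\mathrm{CI}}^{\mathtt{GHulC}}_{N,\alpha}\right)\ \xrightarrow{d}\ \mathscr{G}(W,z_{\alpha/2}),$$ where $\mathscr{G}(a,b):=|a|^{1/\rho}\mathrm{sgn}(a)-|a-b|^{1/\rho}\mathrm{sgn}(a-b)$ and $W\sim N(z_{\alpha/2}/2,\,1/4)$.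
   Context: $z_{\alpha/2}$ is the $(1-\alpha/2)$-quantile of the standard normal distribution. GHulC procedure. Inputs: i.i.d. observations $W_1,\dots,W_N$, confidence level $1-\alpha$, an estimation procedure $\mathcal{A}$ mapping a finite data set to a real number, and a number of batches $B\ge\log_2(2/\alpha)$. (1) Randomly split the data into $B$ disjoint sets (here of approximately equal size $N/B$). (2) Compute $\widehat\theta_j$ by applying $\mathcal{A}$ to the $j$-th set, $1\le j\le B$; let $\widehat\theta_{(1)}\le\dots\le\widehat\theta_{(B)}$ be their order statistics. (3) With $Y_B\sim\mathrm{Bin}(B,1/2)$, let $c_{B,\alpha}$ be the smallest integer $x$ with $\mathbb{P}(Y_B\ge\lfloor B/2\rfloor-x)\ge1-\alpha/2$. (4) Let $P(n,k)=\sum_{i=\lfloor n/2\rfloor-k}^{\lceil n/2\rceil+k}\binom{n}{i}2^{-n}$ and $\tau_\alpha=\frac{P(B,c_{B,\alpha})-(1-\alpha)}{P(B,c_{B,\alpha})-P(B,c_{B,\alpha}-1)}$. Generate $U\sim\mathrm{Uniform}(0,1)$, and set $c^*_{B,\alpha}=c_{B,\alpha}-1$ if $U\le\tau_\alpha$ and $c^*_{B,\alpha}=c_{B,\alpha}$ if $U>\tau_\alpha$. (5) Return $\widehat{\mathrm{CI}}^{\mathtt{GHulC}}_{N,\alpha}=\left[\widehat\theta_{(\lfloor B/2\rfloor-c^*_{B,\alpha})},\ \widehat\theta_{(\lceil B/2\rceil+c^*_{B,\alpha}+1)}\right]$. Width denotes the length of the interval.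
   Formalization: Positivity of M_N and C_N alone makes the claim false; the theorem also assumes M_N√B → ∞ and (C_N/M_N)(M_N√B)^(-Δ/ρ) → 0, which holds whenever M_N is bounded away from 0 and C_N is bounded. Rates r_m are taken positive. *)

theory Defs
  imports "HOL-Probability.Probability"
begin

definition normal_quantile :: "real \<Rightarrow> real" where
  "normal_quantile p = Inf {x. p \<le> cdf std_normal_distribution x}"

text \<open>The sequence \<open>X\<close> is \<open>O\<^sub>p(1)\<close> under \<open>P\<close>.\<close>

definition bounded_in_probability :: "'w measure \<Rightarrow> (nat \<Rightarrow> 'w \<Rightarrow> real) \<Rightarrow> bool" where
  "bounded_in_probability P X \<longleftrightarrow>
     (\<forall>\<epsilon>>0. \<exists>K. \<forall>\<^sub>F m in sequentially. measure P {\<omega> \<in> space P. \<bar>X m \<omega>\<bar> > K} < \<epsilon>)"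

text \<open>
  Independence of two random variables as in \<^const>\<open>prob_space.indep_var\<close>, which requires
  both to have the same type of values.
\<close>

definition indep_rv ::
  "'w measure \<Rightarrow> 'x measure \<Rightarrow> ('w \<Rightarrow> 'x) \<Rightarrow> 'y measure \<Rightarrow> ('w \<Rightarrow> 'y) \<Rightarrow> bool" where
  "indep_rv P S X T Y \<longleftrightarrow>
     X \<in> measurable P S \<and> Y \<in> measurable P T \<and>
     prob_space.indep_set P (sets (vimage_algebra (space P) X S)) (sets (vimage_algebra (space P) Y T))"

text \<open>
  A split of the observations with indices \<open>{..<N}\<close> is given by the index sets \<open>D 0, \<dots>, D (B - 1)\<close>
  of its batches, of prescribed sizes \<open>s 0, \<dots>, s (B - 1)\<close>. The batches are disjoint; they exhaust
  the data if the sizes add up to \<open>N\<close>, while smaller sizes leave a remainder unused.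
\<close>

definition splits :: "nat \<Rightarrow> nat \<Rightarrow> (nat \<Rightarrow> nat) \<Rightarrow> (nat \<Rightarrow> nat set) set" where
  "splits N B s =
     {D \<in> {..<B} \<rightarrow>\<^sub>E Pow {..<N}. disjoint_family_on D {..<B} \<and> (\<forall>j<B. card (D j) = s j)}"

text \<open>The procedure \<open>A\<close> applied to the part of the data \<open>w\<close> with indices in the finite set \<open>I\<close>.\<close>

definition estimate :: "('a list \<Rightarrow> real) \<Rightarrow> (nat \<Rightarrow> 'a) \<Rightarrow> nat set \<Rightarrow> real" where
  "estimate A w I = A (map w (sorted_list_of_set I))"

text \<open>Order statistics are numbered from 1; indices outside \<open>{1..length xs}\<close> are meaningless.\<close>

definition order_stat :: "real list \<Rightarrow> int \<Rightarrow> real" where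
  "order_stat xs i = sort xs ! (nat i - 1)"

definition ghulc_c :: "nat \<Rightarrow> real \<Rightarrow> int" where
  "ghulc_c B \<alpha> =
     (LEAST x::int. measure_pmf.prob (binomial_pmf B (1/2)) {y. int y \<ge> \<lfloor>real B / 2\<rfloor> - x} \<ge> 1 - \<alpha> / 2)"

text \<open>
  The argument \<open>k\<close> is an integer because \<open>k = -1\<close> can occur below. Negative summation indices
  have binomial coefficient zero, so that summing over natural numbers loses nothing.
\<close>

definition ghulc_P :: "nat \<Rightarrow> int \<Rightarrow> real" where
  "ghulc_P n k =
     (\<Sum>i | \<lfloor>real n / 2\<rfloor> - k \<le> int i \<and> int i \<le> \<lceil>real n / 2\<rceil> + k. real (n choose i) / 2 ^ n)"

definition ghulc_tau :: "nat \<Rightarrow> real \<Rightarrow> real" where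
  "ghulc_tau B \<alpha> =
     (ghulc_P B (ghulc_c B \<alpha>) - (1 - \<alpha>)) / (ghulc_P B (ghulc_c B \<alpha>) - ghulc_P B (ghulc_c B \<alpha> - 1))"

definition ghulc_cstar :: "nat \<Rightarrow> real \<Rightarrow> real \<Rightarrow> int" where
  "ghulc_cstar B \<alpha> u = (if u \<le> ghulc_tau B \<alpha> then ghulc_c B \<alpha> - 1 else ghulc_c B \<alpha>)"

definition ghulc_CI ::
  "('a list \<Rightarrow> real) \<Rightarrow> nat \<Rightarrow> real \<Rightarrow> (nat \<Rightarrow> 'a) \<Rightarrow> (nat \<Rightarrow> nat set) \<Rightarrow> real \<Rightarrow> real set" where
  "ghulc_CI A B \<alpha> w D u =
     (let \<theta> = map (\<lambda>j. estimate A w (D j)) [0..<B]; c = ghulc_cstar B \<alpha> u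
      in {order_stat \<theta> (\<lfloor>real B / 2\<rfloor> - c) .. order_stat \<theta> (\<lceil>real B / 2\<rceil> + c + 1)})"

definition width :: "real set \<Rightarrow> real" where
  "width I = measure lborel I"

definition limit_fun :: "real \<Rightarrow> real \<Rightarrow> real \<Rightarrow> real" where
  "limit_fun \<rho> a b =
     \<bar>a\<bar> powr (1 / \<rho>) * sgn a - \<bar>a - b\<bar> powr (1 / \<rho>) * sgn (a - b)"

text \<open>
  The expansion \<open>F t - F 0 \<approx> M k * \<bar>t\<bar> powr \<rho> * sgn t\<close>, with remainder at most
  \<open>C k * \<bar>t\<bar> powr (\<rho> + \<Delta>)\<close>, is used at the scale \<open>t \<approx> (M k * sqrt (B k)) powr (- 1 / \<rho>)\<close>
  on which the main term is of order \<open>1 / sqrt (B k)\<close>. For coefficients that vary with \<open>k\<close>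
  it carries information there if this scale tends to zero and the remainder is negligible
  relative to the main term.
\<close>

definition local_expansion_regime ::
  "real \<Rightarrow> real \<Rightarrow> (nat \<Rightarrow> real) \<Rightarrow> (nat \<Rightarrow> real) \<Rightarrow> (nat \<Rightarrow> nat) \<Rightarrow> bool" where
  "local_expansion_regime \<rho> \<Delta> M C B \<longleftrightarrow>
     filterlim (\<lambda>k. M k * sqrt (real (B k))) at_top sequentially \<and>
     (\<lambda>k. C k / M k * (M k * sqrt (real (B k))) powr (- \<Delta> / \<rho>)) \<longlonglongrightarrow> 0"

text \<open>It is automatic for coefficients bounded away from 0 and infinity, in particular for constants.\<close>

lemma local_expansion_regime_if_bounded:
  assumes "0 < \<rho>" "0 < \<Delta>" "0 < m"
    and M: "\<And>k. m \<le> M k"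
    and C: "\<And>k. 0 < C k" "\<And>k. C k \<le> c"
    and B: "filterlim B at_top sequentially"
  shows "local_expansion_regime \<rho> \<Delta> M C B"
proof -
  have "filterlim (\<lambda>k. sqrt (real (B k))) at_top sequentially"
    by (intro filterlim_compose[OF sqrt_at_top] filterlim_compose[OF filterlim_real_sequentially] B)
  then have "filterlim (\<lambda>k. m * sqrt (real (B k))) at_top sequentially"
    using \<open>0 < m\<close> by (intro filterlim_tendsto_pos_mult_at_top[OF tendsto_const])
  then have lim: "filterlim (\<lambda>k. M k * sqrt (real (B k))) at_top sequentially"
    by (rule filterlim_at_top_mono) (auto intro!: always_eventually mult_right_mono M)
  have "((\<lambda>x::real. x powr (- \<Delta> / \<rho>)) \<longlongrightarrow> 0) at_top"
    using assms(1,2) by (intro tendsto_neg_powr) (auto simp: filterlim_ident)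
  from filterlim_compose[OF this lim]
  have "(\<lambda>k. (c / m) * (M k * sqrt (real (B k))) powr (- \<Delta> / \<rho>)) \<longlonglongrightarrow> 0"
    by (rule tendsto_mult_right_zero)
  moreover have "norm (C k / M k * (M k * sqrt (real (B k))) powr (- \<Delta> / \<rho>))
      \<le> (c / m) * (M k * sqrt (real (B k))) powr (- \<Delta> / \<rho>)" for k
  proof -
    have "0 < M k" "0 < C k" using M[of k] C(1)[of k] \<open>0 < m\<close> by linarith+
    then have "C k / M k \<le> c / m" using M[of k] C[of k] \<open>0 < m\<close> by (intro frac_le) auto
    then have "C k / M k * (M k * sqrt (real (B k))) powr (- \<Delta> / \<rho>)
        \<le> (c / m) * (M k * sqrt (real (B k))) powr (- \<Delta> / \<rho>)"
      by (rule mult_right_mono) simp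
    moreover have "0 \<le> C k / M k * (M k * sqrt (real (B k))) powr (- \<Delta> / \<rho>)"
      using \<open>0 < M k\<close> \<open>0 < C k\<close> by (intro mult_nonneg_nonneg divide_nonneg_nonneg powr_ge_zero) auto
    ultimately show ?thesis unfolding real_norm_def by linarith
  qed
  ultimately have "(\<lambda>k. C k / M k * (M k * sqrt (real (B k))) powr (- \<Delta> / \<rho>)) \<longlonglongrightarrow> 0"
    by (metis (mono_tags, lifting) Lim_null_comparison always_eventually)
  with lim show ?thesis by (simp add: local_expansion_regime_def)
qed

end

theory Submission
  imports Defs "HOL-Real_Asymp.Real_Asymp"
begin

text \<open>
  Let \<open>X\<^sub>j\<close> be the scaled estimation errors of the batches, \<open>\<tau> = (M * sqrt B) powr (- 1 / \<rho>)\<close> and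
  \<open>T x\<close> the number of batches with \<open>X\<^sub>j \<le> x * \<tau>\<close>. A rescaled order statistic of index \<open>i\<close> is at
  most \<open>x\<close> iff \<open>i \<le> T x\<close>. By the expansion of the distribution functions and Chebyshev's
  inequality, \<open>(T x - T 0) / sqrt B\<close> tends to \<open>\<bar>x\<bar> powr \<rho> * sgn x\<close> in probability, so with
  \<open>G = (B - 2 * T 0) / sqrt B\<close> the event becomes \<open>\<beta> + G / 2 \<le> \<bar>x\<bar> powr \<rho> * sgn x + o(1)\<close> where
  \<open>\<beta> = (2 * i - B) / (2 * sqrt B)\<close>. For the two indices used by GHulC, \<open>\<beta>\<close> tends to \<open>z / 2\<close> and
  \<open>- z / 2\<close> by the de Moivre--Laplace theorem, whatever the value of \<open>U\<close>. Hence both endpoints are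
  asymptotically continuous functions of the same variable \<open>G\<close>, which is asymptotically standard
  normal, and \<open>W = z / 2 + G / 2\<close> in the limit.
\<close>

subsection \<open>Signed powers\<close>

text \<open>For \<rho> other than 1 the map \<open>signed_powr (1 / \<rho>)\<close> has derivative 0
  or infinity at 0, so the order statistics cannot be linearised there. Events about them are
  inverted exactly instead, which uses only monotonicity. The scale \<tau> solves
  \<open>M * \<tau> powr \<rho> = 1 / sqrt B\<close>: on it the drift of the count \<open>T\<close>
  is of order \<open>sqrt B\<close>, the size of the fluctuations of \<open>T 0\<close>. Only a
  fraction of order \<open>1 / sqrt B\<close> of the batches is expected to have an error between 0
  and \<open>x * \<tau>\<close>, so the variance of \<open>T x - T 0\<close> is at most of order
  \<open>sqrt B\<close>. Divided by \<open>sqrt B\<close> the increment becomes deterministic, and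
  all randomness stays in \<open>T 0\<close>. Two further sources of randomness shape the proof. The
  split is random, so the batch estimates form a mixture over splits; their independence rests on
  the fact that the law of an estimate depends only on the prescribed size of its batch. And
  \<open>U\<close> makes the index random, so indices are approximated uniformly on the sample
  space.\<close>

definition signed_powr :: "real \<Rightarrow> real \<Rightarrow> real" where
  "signed_powr p x = \<bar>x\<bar> powr p * sgn x"

lemma signed_powr_0 [simp]: "signed_powr p 0 = 0"
  by (simp add: signed_powr_def)

lemma signed_powr_pos: "0 < x \<Longrightarrow> signed_powr p x = x powr p"
  by (simp add: signed_powr_def)

lemma signed_powr_minus: "signed_powr p (- x) = - signed_powr p x"
  by (simp add: signed_powr_def sgn_minus)

lemma signed_powr_neg: "x < 0 \<Longrightarrow> signed_powr p x = - ((- x) powr p)"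
  by (simp add: signed_powr_def)

lemma signed_powr_strict_mono:
  assumes "0 < p" "x < y"
  shows "signed_powr p x < signed_powr p y"
proof -
  consider "0 < x" | "x = 0" | "x < 0" "0 < y" | "x < 0" "y = 0" | "y < 0"
    by linarith
  then show ?thesis
  proof cases
    case 3
    then have "signed_powr p x < 0" "0 < signed_powr p y" by (auto simp: signed_powr_pos signed_powr_neg)
    then show ?thesis by linarith
  qed (use assms in \<open>auto simp: signed_powr_pos signed_powr_neg intro!: powr_less_mono2\<close>)
qed

lemma signed_powr_mono: "0 < p \<Longrightarrow> x \<le> y \<Longrightarrow> signed_powr p x \<le> signed_powr p y"
  using signed_powr_strict_mono[of p x y] by (cases "x = y") auto

lemma signed_powr_le_iff: "0 < p \<Longrightarrow> signed_powr p x \<le> signed_powr p y \<longleftrightarrow> x \<le> y"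
  using signed_powr_mono[of p x y] signed_powr_strict_mono[of p y x] by (auto simp: not_le[symmetric])

lemma signed_powr_signed_powr: "signed_powr q (signed_powr p x) = signed_powr (p * q) x"
proof -
  consider "0 < x" | "x = 0" | "x < 0" by linarith
  then show ?thesis
    by cases (auto simp: signed_powr_pos signed_powr_neg signed_powr_minus powr_powr)
qed

lemma signed_powr_1 [simp]: "signed_powr 1 x = x"
  by (simp add: signed_powr_def abs_mult_sgn)

text \<open>The signed powers with exponents \<open>p\<close> and \<open>1 / p\<close> are mutually
  inverse increasing bijections. This moves a bound on a count to a bound on an endpoint.\<close>

lemma le_signed_powr_inverse_iff: "0 < p \<Longrightarrow> signed_powr (1 / p) w \<le> x \<longleftrightarrow> w \<le> signed_powr p x"
  using signed_powr_le_iff[of p "signed_powr (1 / p) w" x] by (simp add: signed_powr_signed_powr)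

lemma signed_powr_mult: "0 < c \<Longrightarrow> signed_powr p (c * x) = c powr p * signed_powr p x"
  by (simp add: signed_powr_def abs_mult powr_mult sgn_mult)

lemma isCont_signed_powr:
  assumes "0 < p"
  shows "isCont (signed_powr p) x"
proof -
  \<comment> \<open>\<open>sgn\<close> jumps at 0. With positive and negative parts each power has a
    nonnegative base, where a positive exponent gives continuity also at 0.\<close>
  have "signed_powr p = (\<lambda>x. (max 0 x) powr p - (max 0 (- x)) powr p)"
    by (auto simp: fun_eq_iff signed_powr_def sgn_if max_def)
  then show ?thesis
    using assms by (auto intro!: continuous_intros)
qed

lemma limit_fun_eq_signed_powr: "limit_fun \<rho> a b = signed_powr (1 / \<rho>) a - signed_powr (1 / \<rho>) (a - b)"
  by (simp add: limit_fun_def signed_powr_def)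

subsection \<open>Order statistics\<close>

text \<open>In a sorted list the entries up to \<open>x\<close> form an initial segment, whose
  length is their number. The inequality on the right is strict because \<open>nth\<close> counts
  from 0.\<close>

lemma sort_nth_le_iff:
  fixes xs :: "'a::linorder list"
  assumes "n < length xs"
  shows "sort xs ! n \<le> x \<longleftrightarrow> n < length (filter (\<lambda>y. y \<le> x) xs)"
proof -
  let ?f = "filter (\<lambda>y. y \<le> x)"
  have "length (?f xs) = length (?f (sort xs))"
    by (metis mset_filter mset_sort size_mset)
  also have "\<dots> = card {i. i < length xs \<and> sort xs ! i \<le> x}"
    by (simp add: length_filter_conv_card)
  finally have len: "length (?f xs) = card {i. i < length xs \<and> sort xs ! i \<le> x}" .
  have mono: "i \<le> j \<Longrightarrow> j < length xs \<Longrightarrow> sort xs ! i \<le> sort xs ! j" for i j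
    by (rule sorted_nth_mono) auto
  show ?thesis
  proof
    assume "sort xs ! n \<le> x"
    then have "{..n} \<subseteq> {i. i < length xs \<and> sort xs ! i \<le> x}"
      using mono[of _ n] assms by (auto intro: order_trans)
    from card_mono[OF _ this] show "n < length (?f xs)" unfolding len by simp
  next
    assume n: "n < length (?f xs)"
    show "sort xs ! n \<le> x"
    proof (rule ccontr)
      assume above: "\<not> sort xs ! n \<le> x"
      have "i < n" if "i < length xs" "sort xs ! i \<le> x" for i
        using mono[of n i] that above by (meson not_le order_trans)
      then have "{i. i < length xs \<and> sort xs ! i \<le> x} \<subseteq> {..<n}" by auto
      from card_mono[OF _ this] n show False unfolding len by simp
    qed
  qed
qed

lemma order_stat_le_iff:
  assumes "1 \<le> i" "i \<le> int (length xs)"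
  shows "order_stat xs i \<le> x \<longleftrightarrow> i \<le> int (length (filter (\<lambda>y. y \<le> x) xs))"
  using assms unfolding order_stat_def by (subst sort_nth_le_iff) auto

lemma order_stat_mono:
  assumes "1 \<le> i" "i \<le> j" "j \<le> int (length xs)"
  shows "order_stat xs i \<le> order_stat xs j"
  unfolding order_stat_def using assms by (intro sorted_nth_mono) auto

text \<open>Beyond the end, \<open>nth\<close> returns an unspecified value that depends on the list
  only through its length. An order statistic with index out of range is thus constant on the sample
  space.\<close>

lemma nth_beyond_length: "length xs \<le> n \<Longrightarrow> xs ! n = [] ! (n - length xs)"
  using nth_append[of xs "[]" n] by simp

text \<open>Sublevel sets are described by counting. Every integer \<open>i\<close> is covered,
  since a random index is later treated by a countable case distinction over all its conceivable
  values, some out of range.\<close>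

lemma borel_measurable_order_stat:
  fixes Y :: "nat \<Rightarrow> 'w \<Rightarrow> real"
  assumes [measurable]: "\<And>j. j < n \<Longrightarrow> Y j \<in> borel_measurable \<Omega>"
  shows "(\<lambda>\<omega>. order_stat (map (\<lambda>j. Y j \<omega>) [0..<n]) i) \<in> borel_measurable \<Omega>"
proof (cases "nat i - 1 < n")
  case True
  have "(\<lambda>\<omega>. sort (map (\<lambda>j. Y j \<omega>) [0..<n]) ! (nat i - 1)) \<in> borel_measurable \<Omega>"
  proof (rule borel_measurable_iff_le[THEN iffD2], rule allI)
    fix x
    have "real (length (filter (\<lambda>y. y \<le> x) (map (\<lambda>j. Y j \<omega>) [0..<m])))
        = (\<Sum>j<m. if Y j \<omega> \<le> x then 1 else 0)" for \<omega> m
      by (induction m) auto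
    note count = this[of _ n]
    have "(sort (map (\<lambda>j. Y j \<omega>) [0..<n]) ! (nat i - 1) \<le> x)
        = (real (nat i - 1) < (\<Sum>j<n. if Y j \<omega> \<le> x then 1 else 0))" for \<omega>
      using True unfolding count[symmetric] of_nat_less_iff by (intro sort_nth_le_iff) simp
    then have "{\<omega> \<in> space \<Omega>. sort (map (\<lambda>j. Y j \<omega>) [0..<n]) ! (nat i - 1) \<le> x}
        = {\<omega> \<in> space \<Omega>. real (nat i - 1) < (\<Sum>j<n. if Y j \<omega> \<le> x then 1 else 0)}"
      by simp
    also have "\<dots> \<in> sets \<Omega>" by measurable
    finally show "{\<omega> \<in> space \<Omega>. sort (map (\<lambda>j. Y j \<omega>) [0..<n]) ! (nat i - 1) \<le> x} \<in> sets \<Omega>" .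
  qed
  then show ?thesis by (simp add: order_stat_def)
next
  case False
  then have "order_stat (map (\<lambda>j. Y j \<omega>) [0..<n]) i = [] ! (nat i - 1 - n)" for \<omega>
    unfolding order_stat_def by (subst nth_beyond_length) auto
  then show ?thesis by simp
qed

subsection \<open>Convergence in probability\<close>

definition null_in_probability :: "'w measure \<Rightarrow> (nat \<Rightarrow> 'w \<Rightarrow> real) \<Rightarrow> bool" where
  "null_in_probability \<Omega> X \<longleftrightarrow>
     (\<forall>\<epsilon>>0. (\<lambda>k. measure \<Omega> {\<omega> \<in> space \<Omega>. \<epsilon> < \<bar>X k \<omega>\<bar>}) \<longlonglongrightarrow> 0)"

context prob_space
begin

lemma null_in_probabilityD:
  assumes "null_in_probability M X" "0 < \<epsilon>" "0 < e"
  shows "\<forall>\<^sub>F k in sequentially. prob {\<omega> \<in> space M. \<epsilon> < \<bar>X k \<omega>\<bar>} < e"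
  using assms order_tendstoD(2)[of "\<lambda>k. prob {\<omega> \<in> space M. \<epsilon> < \<bar>X k \<omega>\<bar>}" 0 sequentially e]
  by (auto simp: null_in_probability_def)

lemma tendsto_prob_zeroI:
  assumes "\<And>e. 0 < e \<Longrightarrow> \<forall>\<^sub>F k in sequentially. prob (A k) < e"
  shows "(\<lambda>k. prob (A k)) \<longlonglongrightarrow> 0"
  unfolding tendsto_iff using assms by simp

lemma tendsto_prob_zero_mono:
  assumes "\<forall>\<^sub>F k in sequentially. A k \<subseteq> C k" "\<And>k. C k \<in> events" "(\<lambda>k. prob (C k)) \<longlonglongrightarrow> 0"
  shows "(\<lambda>k. prob (A k)) \<longlonglongrightarrow> 0"
proof (rule Lim_null_comparison[OF _ assms(3)])
  show "\<forall>\<^sub>F k in sequentially. norm (prob (A k)) \<le> prob (C k)"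
    using assms(1) by eventually_elim (simp add: finite_measure_mono assms(2))
qed

lemma null_in_probability_diff:
  assumes [measurable]: "\<And>k. random_variable borel (X k)" "\<And>k. random_variable borel (Y k)"
    and "null_in_probability M X" "null_in_probability M Y"
  shows "null_in_probability M (\<lambda>k \<omega>. X k \<omega> - Y k \<omega>)"
  unfolding null_in_probability_def
proof (intro allI impI)
  fix \<epsilon> :: real assume "0 < \<epsilon>"
  let ?A = "\<lambda>k. {\<omega> \<in> space M. \<epsilon> / 2 < \<bar>X k \<omega>\<bar>}" and ?B = "\<lambda>k. {\<omega> \<in> space M. \<epsilon> / 2 < \<bar>Y k \<omega>\<bar>}"
  have "(\<lambda>k. prob (?A k) + prob (?B k)) \<longlonglongrightarrow> 0 + 0"
    using assms(3,4) half_gt_zero[OF \<open>0 < \<epsilon>\<close>] unfolding null_in_probability_def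
    by (intro tendsto_add) blast+
  moreover have "norm (prob {\<omega> \<in> space M. \<epsilon> < \<bar>X k \<omega> - Y k \<omega>\<bar>}) \<le> prob (?A k) + prob (?B k)" for k
  proof -
    have "prob {\<omega> \<in> space M. \<epsilon> < \<bar>X k \<omega> - Y k \<omega>\<bar>} \<le> prob (?A k \<union> ?B k)"
      by (rule finite_measure_mono) auto
    also have "\<dots> \<le> prob (?A k) + prob (?B k)"
      by (rule measure_Un_le) auto
    finally show ?thesis by simp
  qed
  ultimately show "(\<lambda>k. prob {\<omega> \<in> space M. \<epsilon> < \<bar>X k \<omega> - Y k \<omega>\<bar>}) \<longlonglongrightarrow> 0"
    by (metis (no_types, lifting) Lim_null_comparison add_0 always_eventually)
qed

text \<open>
  If \<open>X\<close> and \<open>Y\<close> differ by more than \<open>\<epsilon>\<close> while \<open>Y\<close> is bounded, they lie on different sides of an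
  interval between neighbouring points of a fixed finite grid.
\<close>

lemma null_in_probability_if_no_crossing:
  assumes [measurable]: "\<And>k. random_variable borel (X k)" "\<And>k. random_variable borel (Y k)"
    and bounded: "bounded_in_probability M Y"
    and up: "\<And>x y. x < y \<Longrightarrow> (\<lambda>k. prob {\<omega> \<in> space M. Y k \<omega> \<le> x \<and> y < X k \<omega>}) \<longlonglongrightarrow> 0"
    and down: "\<And>x y. x < y \<Longrightarrow> (\<lambda>k. prob {\<omega> \<in> space M. X k \<omega> \<le> x \<and> y < Y k \<omega>}) \<longlonglongrightarrow> 0"
  shows "null_in_probability M (\<lambda>k \<omega>. X k \<omega> - Y k \<omega>)"
  unfolding null_in_probability_def
proof (intro allI impI tendsto_prob_zeroI)
  fix \<epsilon> e :: real assume "0 < \<epsilon>" "0 < e"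
  obtain K where K: "\<forall>\<^sub>F k in sequentially. prob {\<omega> \<in> space M. K < \<bar>Y k \<omega>\<bar>} < e / 2"
    using bounded \<open>0 < e\<close> unfolding bounded_in_probability_def by (meson half_gt_zero)
  define \<delta> where "\<delta> = \<epsilon> / 2"
  then have "0 < \<delta>" using \<open>0 < \<epsilon>\<close> by simp
  \<comment> \<open>Grid points at distance \<open>\<delta> = \<epsilon> / 2\<close>, starting at
    \<open>- K\<close>; \<open>n\<close> is the number of the cell of \<open>K\<close>, so the cells
    cover \<open>{- K..K}\<close>.\<close>
  define g where "g i = - K + real i * \<delta>" for i
  define n where "n = nat \<lfloor>2 * K / \<delta>\<rfloor>"
  \<comment> \<open>If \<open>Y\<close> lies between \<open>g i\<close> and
    \<open>g i + \<delta>\<close> and \<open>X\<close> is more than \<open>2 * \<delta>\<close>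
    away, then \<open>X\<close> is above \<open>g i + 2 * \<delta>\<close> or below
    \<open>g i - \<delta>\<close>. The halves of \<delta> leave the strict gap that
    \<open>up\<close> and \<open>down\<close> ask for.\<close>
  define U where "U i k = {\<omega> \<in> space M. Y k \<omega> \<le> g i + \<delta> \<and> g i + 3 / 2 * \<delta> < X k \<omega>}" for i k
  define L where "L i k = {\<omega> \<in> space M. X k \<omega> \<le> g i - \<delta> \<and> g i - \<delta> / 2 < Y k \<omega>}" for i k
  have [measurable]: "U i k \<in> events" "L i k \<in> events" for i k
    unfolding U_def L_def by measurable
  have "(\<lambda>k. prob (U i k) + prob (L i k)) \<longlonglongrightarrow> 0 + 0" for i
    unfolding U_def L_def using \<open>0 < \<delta>\<close> by (intro tendsto_add up down) auto
  then have "(\<lambda>k. \<Sum>i\<le>n. prob (U i k) + prob (L i k)) \<longlonglongrightarrow> (\<Sum>i\<le>n. 0)"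
    by (intro tendsto_sum) simp
  then have "\<forall>\<^sub>F k in sequentially. (\<Sum>i\<le>n. prob (U i k) + prob (L i k)) < e / 2"
    using \<open>0 < e\<close> by (intro order_tendstoD(2)) auto
  with K show "\<forall>\<^sub>F k in sequentially. prob {\<omega> \<in> space M. \<epsilon> < \<bar>X k \<omega> - Y k \<omega>\<bar>} < e"
  proof eventually_elim
    case (elim k)
    have "{\<omega> \<in> space M. \<epsilon> < \<bar>X k \<omega> - Y k \<omega>\<bar>}
        \<subseteq> {\<omega> \<in> space M. K < \<bar>Y k \<omega>\<bar>} \<union> (\<Union>i\<le>n. U i k \<union> L i k)"
    proof safe
      fix \<omega> assume \<omega>: "\<omega> \<in> space M" "\<epsilon> < \<bar>X k \<omega> - Y k \<omega>\<bar>" "\<omega> \<notin> (\<Union>i\<le>n. U i k \<union> L i k)"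
      show "K < \<bar>Y k \<omega>\<bar>"
      proof (rule ccontr)
        assume "\<not> K < \<bar>Y k \<omega>\<bar>"
        then have Y: "- K \<le> Y k \<omega>" "Y k \<omega> \<le> K" by auto
        define i where "i = nat \<lfloor>(Y k \<omega> + K) / \<delta>\<rfloor>"
        have "0 \<le> (Y k \<omega> + K) / \<delta>" using Y \<open>0 < \<delta>\<close> by simp
        then have "real i \<le> (Y k \<omega> + K) / \<delta>" "(Y k \<omega> + K) / \<delta> < real i + 1"
          unfolding i_def by linarith+
        then have g: "g i \<le> Y k \<omega>" "Y k \<omega> \<le> g i + \<delta>"
          using \<open>0 < \<delta>\<close> by (auto simp: g_def field_simps)
        have "i \<le> n"
          unfolding i_def n_def using Y \<open>0 < \<delta>\<close> by (intro nat_mono floor_mono divide_right_mono) auto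
        with \<omega>(1,3) have "\<omega> \<notin> U i k" "\<omega> \<notin> L i k" by auto
        then show False using g \<omega>(1,2) \<open>0 < \<delta>\<close> \<delta>_def unfolding U_def L_def by auto
      qed
    qed
    then have "prob {\<omega> \<in> space M. \<epsilon> < \<bar>X k \<omega> - Y k \<omega>\<bar>}
        \<le> prob ({\<omega> \<in> space M. K < \<bar>Y k \<omega>\<bar>} \<union> (\<Union>i\<le>n. U i k \<union> L i k))"
      by (rule finite_measure_mono) measurable
    also have "\<dots> \<le> prob {\<omega> \<in> space M. K < \<bar>Y k \<omega>\<bar>} + prob (\<Union>i\<le>n. U i k \<union> L i k)"
      by (rule measure_Un_le) measurable
    also have "prob (\<Union>i\<le>n. U i k \<union> L i k) \<le> (\<Sum>i\<le>n. prob (U i k \<union> L i k))"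
      by (rule finite_measure_subadditive_finite) auto
    also have "\<dots> \<le> (\<Sum>i\<le>n. prob (U i k) + prob (L i k))"
      by (intro sum_mono measure_Un_le) auto
    finally show ?case using elim by linarith
  qed
qed

text \<open>Crossings are tested at fixed \<open>x\<close> only, so smallness of
  \<open>R k x\<close> for each single \<open>x\<close> suffices. The thresholds
  \<open>\<beta>\<close> may be random, as the GHulC index is, provided they approach
  \<open>b\<close> uniformly.\<close>

lemma null_in_probability_if_threshold:
  fixes \<beta> \<gamma> :: "nat \<Rightarrow> 'a \<Rightarrow> real"
  assumes [measurable]: "\<And>k. random_variable borel (X k)" "\<And>k. random_variable borel (G k)"
      "\<And>k x. random_variable borel (R k x)"
    and "0 < \<rho>"
    and bounded: "bounded_in_probability M (\<lambda>k \<omega>. signed_powr (1 / \<rho>) (b + G k \<omega>))"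
    and null: "\<And>x. null_in_probability M (\<lambda>k. R k x)"
    and \<beta>: "\<And>\<delta>. 0 < \<delta> \<Longrightarrow> \<forall>\<^sub>F k in sequentially. \<forall>\<omega>\<in>space M. \<bar>\<beta> k \<omega> - b\<bar> < \<delta>"
    and le_iff: "\<And>x. \<forall>\<^sub>F k in sequentially. \<forall>\<omega>\<in>space M.
        X k \<omega> \<le> x \<longleftrightarrow> \<beta> k \<omega> + G k \<omega> \<le> signed_powr \<rho> x + R k x \<omega>"
  shows "null_in_probability M (\<lambda>k \<omega>. X k \<omega> - signed_powr (1 / \<rho>) (b + G k \<omega>))"
proof (rule null_in_probability_if_no_crossing[OF _ _ bounded])
  have signed_powr_meas [measurable]: "signed_powr (1 / \<rho>) \<in> borel_measurable borel"
    using \<open>0 < \<rho>\<close> by (intro borel_measurable_continuous_onI continuous_at_imp_continuous_on)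
      (auto intro!: isCont_signed_powr)
  show "random_variable borel (\<lambda>\<omega>. signed_powr (1 / \<rho>) (b + G k \<omega>))" for k
    by measurable
  fix x y :: real assume "x < y"
  \<comment> \<open>A third of the gap: with \<open>\<beta>\<close> within \<delta> of
    \<open>b\<close>, a crossing forces \<open>\<bar>R\<bar> > 2 * \<delta>\<close>, at
    \<open>y\<close> if \<open>X\<close> is the larger variable and at \<open>x\<close> if it is the
    smaller one.\<close>
  define \<delta> where "\<delta> = (signed_powr \<rho> y - signed_powr \<rho> x) / 3"
  have "0 < \<delta>" using signed_powr_strict_mono[OF \<open>0 < \<rho>\<close> \<open>x < y\<close>] by (simp add: \<delta>_def)
  have null': "(\<lambda>k. prob {\<omega> \<in> space M. \<delta> < \<bar>R k z \<omega>\<bar>}) \<longlonglongrightarrow> 0" for z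
    using null[of z] \<open>0 < \<delta>\<close> by (auto simp: null_in_probability_def)
  have "\<forall>\<^sub>F k in sequentially. {\<omega> \<in> space M. signed_powr (1 / \<rho>) (b + G k \<omega>) \<le> x \<and> y < X k \<omega>}
      \<subseteq> {\<omega> \<in> space M. \<delta> < \<bar>R k y \<omega>\<bar>}"
    using \<beta>[OF \<open>0 < \<delta>\<close>] le_iff[of y]
  proof eventually_elim
    case (elim k)
    show ?case
    proof safe
      fix \<omega> assume \<omega>: "\<omega> \<in> space M" "signed_powr (1 / \<rho>) (b + G k \<omega>) \<le> x" "y < X k \<omega>"
      from \<omega>(2) have "b + G k \<omega> \<le> signed_powr \<rho> x" using le_signed_powr_inverse_iff[OF \<open>0 < \<rho>\<close>] by blast
      moreover have "signed_powr \<rho> y + R k y \<omega> < \<beta> k \<omega> + G k \<omega>" using elim(2) \<omega>(1,3) by (metis not_le)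
      moreover have "\<bar>\<beta> k \<omega> - b\<bar> < \<delta>" using elim(1) \<omega>(1) by blast
      moreover have "signed_powr \<rho> y - signed_powr \<rho> x = 3 * \<delta>" by (simp add: \<delta>_def)
      ultimately show "\<delta> < \<bar>R k y \<omega>\<bar>" using \<open>0 < \<delta>\<close> by linarith
    qed
  qed
  then show "(\<lambda>k. prob {\<omega> \<in> space M. signed_powr (1 / \<rho>) (b + G k \<omega>) \<le> x \<and> y < X k \<omega>}) \<longlonglongrightarrow> 0"
    by (rule tendsto_prob_zero_mono[OF _ _ null']) measurable
  have "\<forall>\<^sub>F k in sequentially. {\<omega> \<in> space M. X k \<omega> \<le> x \<and> y < signed_powr (1 / \<rho>) (b + G k \<omega>)}
      \<subseteq> {\<omega> \<in> space M. \<delta> < \<bar>R k x \<omega>\<bar>}"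
    using \<beta>[OF \<open>0 < \<delta>\<close>] le_iff[of x]
  proof eventually_elim
    case (elim k)
    show ?case
    proof safe
      fix \<omega> assume \<omega>: "\<omega> \<in> space M" "X k \<omega> \<le> x" "y < signed_powr (1 / \<rho>) (b + G k \<omega>)"
      from \<omega>(3) have "signed_powr \<rho> y < b + G k \<omega>" using le_signed_powr_inverse_iff[OF \<open>0 < \<rho>\<close>] by (meson not_le)
      moreover have "\<beta> k \<omega> + G k \<omega> \<le> signed_powr \<rho> x + R k x \<omega>" using elim(2) \<omega>(1,2) by blast
      moreover have "\<bar>\<beta> k \<omega> - b\<bar> < \<delta>" using elim(1) \<omega>(1) by blast
      moreover have "signed_powr \<rho> y - signed_powr \<rho> x = 3 * \<delta>" by (simp add: \<delta>_def)
      ultimately show "\<delta> < \<bar>R k x \<omega>\<bar>" using \<open>0 < \<delta>\<close> by linarith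
    qed
  qed
  then show "(\<lambda>k. prob {\<omega> \<in> space M. X k \<omega> \<le> x \<and> y < signed_powr (1 / \<rho>) (b + G k \<omega>)}) \<longlonglongrightarrow> 0"
    by (rule tendsto_prob_zero_mono[OF _ _ null']) measurable
qed measurable

lemma bounded_in_probability_compose:
  assumes [measurable]: "\<And>k. random_variable borel (X k)"
    and bounded: "bounded_in_probability M X" and g: "\<And>x. isCont g x"
  shows "bounded_in_probability M (\<lambda>k \<omega>. g (X k \<omega>))"
  unfolding bounded_in_probability_def
proof (intro allI impI)
  fix e :: real assume "0 < e"
  then obtain K where K: "\<forall>\<^sub>F k in sequentially. prob {\<omega> \<in> space M. K < \<bar>X k \<omega>\<bar>} < e"
    using bounded unfolding bounded_in_probability_def by blast
  have "bounded (g ` {- K..K})"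
    using g by (intro compact_imp_bounded compact_continuous_image continuous_at_imp_continuous_on) auto
  then obtain L where L: "\<And>x. x \<in> {- K..K} \<Longrightarrow> \<bar>g x\<bar> \<le> L"
    unfolding bounded_iff by (metis imageI real_norm_def)
  have "prob {\<omega> \<in> space M. L < \<bar>g (X k \<omega>)\<bar>} \<le> prob {\<omega> \<in> space M. K < \<bar>X k \<omega>\<bar>}" for k
  proof (rule finite_measure_mono)
    show "{\<omega> \<in> space M. L < \<bar>g (X k \<omega>)\<bar>} \<subseteq> {\<omega> \<in> space M. K < \<bar>X k \<omega>\<bar>}"
      using L by (auto simp: not_le[symmetric] abs_le_iff)
  qed measurable
  with K have "\<forall>\<^sub>F k in sequentially. prob {\<omega> \<in> space M. L < \<bar>g (X k \<omega>)\<bar>} < e"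
    by (auto elim!: eventually_mono intro: le_less_trans)
  then show "\<exists>L. \<forall>\<^sub>F k in sequentially. prob {\<omega> \<in> space M. L < \<bar>g (X k \<omega>)\<bar>} < e" by blast
qed

lemma bounded_in_probability_if_weak_conv:
  assumes [measurable]: "\<And>k. random_variable borel (X k)"
    and conv: "weak_conv_m (\<lambda>k. distr M borel (X k)) \<mu>"
    and "real_distribution \<mu>" and cont: "\<And>x. isCont (cdf \<mu>) x"
  shows "bounded_in_probability M X"
  unfolding bounded_in_probability_def
proof (intro allI impI)
  fix e :: real assume "0 < e"
  interpret \<mu>: real_distribution \<mu> by fact
  have cdf: "(\<lambda>k. prob {\<omega> \<in> space M. X k \<omega> \<le> x}) \<longlonglongrightarrow> cdf \<mu> x" for x
    using conv cont[of x] by (simp add: weak_conv_m_def weak_conv_def cdf_def measure_distr vimage_def Int_def conj_commute)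
  \<comment> \<open>The limit cdf is continuous, so the cdfs converge at every point;
    \<open>i\<close> and \<open>- i\<close> far out enclose all but \<open>e\<close> of the limiting
    mass.\<close>
  have "(\<lambda>i. (1 - cdf \<mu> (real i)) + cdf \<mu> (- real i)) \<longlonglongrightarrow> (1 - 1) + 0"
    by (intro tendsto_intros \<mu>.cdf_lim_infty_prob \<mu>.cdf_lim_neg_infty)
  then have "\<forall>\<^sub>F i in sequentially. (1 - cdf \<mu> (real i)) + cdf \<mu> (- real i) < e"
    using \<open>0 < e\<close> by (intro order_tendstoD(2)) auto
  then obtain i where i: "(1 - cdf \<mu> (real i)) + cdf \<mu> (- real i) < e"
    by (auto simp: eventually_sequentially)
  have "(\<lambda>k. (1 - prob {\<omega> \<in> space M. X k \<omega> \<le> real i}) + prob {\<omega> \<in> space M. X k \<omega> \<le> - real i})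
      \<longlonglongrightarrow> (1 - cdf \<mu> (real i)) + cdf \<mu> (- real i)"
    by (intro tendsto_intros cdf)
  from order_tendstoD(2)[OF this i]
  have "\<forall>\<^sub>F k in sequentially. prob {\<omega> \<in> space M. real i < \<bar>X k \<omega>\<bar>} < e"
  proof eventually_elim
    case (elim k)
    have "prob {\<omega> \<in> space M. real i < \<bar>X k \<omega>\<bar>}
        \<le> prob ({\<omega> \<in> space M. \<not> X k \<omega> \<le> real i} \<union> {\<omega> \<in> space M. X k \<omega> \<le> - real i})"
      by (rule finite_measure_mono) auto
    also have "\<dots> \<le> prob {\<omega> \<in> space M. \<not> X k \<omega> \<le> real i} + prob {\<omega> \<in> space M. X k \<omega> \<le> - real i}"
      by (rule measure_Un_le) auto
    also have "prob {\<omega> \<in> space M. \<not> X k \<omega> \<le> real i} = 1 - prob {\<omega> \<in> space M. X k \<omega> \<le> real i}"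
      by (rule prob_neg) measurable
    finally show ?case using elim by linarith
  qed
  then show "\<exists>K. \<forall>\<^sub>F k in sequentially. prob {\<omega> \<in> space M. K < \<bar>X k \<omega>\<bar>} < e" by blast
qed

text \<open>Continuous mapping and Slutsky's theorem in one. The functions \<open>cts_step\<close>
  are bounded and uniformly continuous, so the perturbation changes their expectations by a
  vanishing amount; composed with \<open>g\<close> they are bounded continuous test functions for
  the laws of \<open>Y\<close>.\<close>

lemma weak_conv_continuous_map_perturbed:
  assumes [measurable]: "\<And>k. random_variable borel (X k)" "\<And>k. random_variable borel (Y k)"
    and conv: "weak_conv_m (\<lambda>k. distr M borel (Y k)) \<mu>" and "real_distribution \<mu>"
    and g: "\<And>x. isCont g x"
    and null: "null_in_probability M (\<lambda>k \<omega>. X k \<omega> - g (Y k \<omega>))"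
  shows "weak_conv_m (\<lambda>k. distr M borel (X k)) (distr \<mu> borel g)"
proof -
  interpret \<mu>: real_distribution \<mu> by fact
  have [measurable]: "g \<in> borel_measurable borel"
    using g by (intro borel_measurable_continuous_onI continuous_at_imp_continuous_on) auto
  show ?thesis
  proof (rule integral_cts_step_conv_imp_weak_conv)
    show "real_distribution (distr M borel (X k))" for k by (rule real_distribution_distr) measurable
    show "real_distribution (distr \<mu> borel g)" by (rule \<mu>.real_distribution_distr) measurable
    fix a b :: real assume "a < b"
    let ?f = "cts_step a b"
    have f_cont: "isCont ?f x" for x
      using uniformly_continuous_imp_continuous[OF cts_step_uniformly_continuous[OF \<open>a < b\<close>]]
      by (simp add: continuous_on_eq_continuous_at)
    have f_bound: "0 \<le> ?f x" "?f x \<le> 1" for x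
      using \<open>a < b\<close> by (auto simp: cts_step_def field_simps)
    have [measurable]: "?f \<in> borel_measurable borel"
      using f_cont by (intro borel_measurable_continuous_onI continuous_at_imp_continuous_on) auto
    have int: "integrable M (\<lambda>\<omega>. ?f (h \<omega>))" if [measurable]: "random_variable borel h" for h
      by (rule integrable_const_bound[where B = 1]) (auto simp: f_bound)
    have lim: "(\<lambda>k. expectation (\<lambda>\<omega>. ?f (g (Y k \<omega>)))) \<longlonglongrightarrow> (LINT x|\<mu>. ?f (g x))"
    proof -
      have "(\<lambda>k. LINT x|distr M borel (Y k). ?f (g x)) \<longlonglongrightarrow> (LINT x|\<mu>. ?f (g x))"
      proof (rule weak_conv_imp_integral_bdd_continuous_conv[OF _ _ conv])
        show "real_distribution (distr M borel (Y k))" for k by (rule real_distribution_distr) measurable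
        show "isCont (\<lambda>x. ?f (g x)) x" for x by (rule isCont_o2[OF g f_cont])
        show "norm (?f (g x)) \<le> 1" for x using f_bound by simp
      qed fact
      then show ?thesis by (simp add: integral_distr)
    qed
    have diff: "(\<lambda>k. expectation (\<lambda>\<omega>. ?f (X k \<omega>)) - expectation (\<lambda>\<omega>. ?f (g (Y k \<omega>)))) \<longlonglongrightarrow> 0"
      unfolding tendsto_iff
    proof (intro allI impI)
      fix e :: real assume "0 < e"
      obtain d where "0 < d" and d: "\<And>x y. dist x y < d \<Longrightarrow> dist (?f x) (?f y) < e / 2"
        using cts_step_uniformly_continuous[OF \<open>a < b\<close>] \<open>0 < e\<close>
        unfolding uniformly_continuous_on_def by (metis UNIV_I half_gt_zero)
      have "\<forall>\<^sub>F k in sequentially. prob {\<omega> \<in> space M. d / 2 < \<bar>X k \<omega> - g (Y k \<omega>)\<bar>} < e / 2"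
        using \<open>0 < d\<close> \<open>0 < e\<close> by (intro null_in_probabilityD[OF null]) auto
      then show "\<forall>\<^sub>F k in sequentially.
          dist (expectation (\<lambda>\<omega>. ?f (X k \<omega>)) - expectation (\<lambda>\<omega>. ?f (g (Y k \<omega>)))) 0 < e"
      proof eventually_elim
        case (elim k)
        let ?A = "{\<omega> \<in> space M. d / 2 < \<bar>X k \<omega> - g (Y k \<omega>)\<bar>}"
        have "\<bar>expectation (\<lambda>\<omega>. ?f (X k \<omega>)) - expectation (\<lambda>\<omega>. ?f (g (Y k \<omega>)))\<bar>
            = \<bar>expectation (\<lambda>\<omega>. ?f (X k \<omega>) - ?f (g (Y k \<omega>)))\<bar>"
          by (simp add: int)
        also have "\<dots> \<le> expectation (\<lambda>\<omega>. \<bar>?f (X k \<omega>) - ?f (g (Y k \<omega>))\<bar>)"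
          by (rule integral_abs_bound)
        \<comment> \<open>Off \<open>?A\<close> uniform continuity gives \<open>e / 2\<close>; on
          \<open>?A\<close> two values in \<open>{0..1}\<close> differ by at most 1.\<close>
        also have "\<dots> \<le> expectation (\<lambda>\<omega>. e / 2 + indicator ?A \<omega>)"
        proof (rule integral_mono)
          show "integrable M (\<lambda>\<omega>. \<bar>?f (X k \<omega>) - ?f (g (Y k \<omega>))\<bar>)"
            by (intro integrable_abs Bochner_Integration.integrable_diff int) measurable
          show "integrable M (\<lambda>\<omega>. e / 2 + indicator ?A \<omega>)"
            by (intro Bochner_Integration.integrable_add integrable_const integrable_real_indicator)
              (auto simp: emeasure_eq_measure)
          fix \<omega> assume "\<omega> \<in> space M"
          show "\<bar>?f (X k \<omega>) - ?f (g (Y k \<omega>))\<bar> \<le> e / 2 + indicator ?A \<omega>"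
          proof (cases "\<omega> \<in> ?A")
            case True
            then show ?thesis
              using f_bound[of "X k \<omega>"] f_bound[of "g (Y k \<omega>)"] \<open>0 < e\<close> by (auto simp: abs_if)
          next
            case False
            then have "dist (X k \<omega>) (g (Y k \<omega>)) < d"
              using \<open>\<omega> \<in> space M\<close> \<open>0 < d\<close> by (auto simp: dist_real_def)
            from d[OF this] False show ?thesis by (simp add: dist_real_def)
          qed
        qed
        also have "\<dots> = e / 2 + prob ?A"
          by (subst Bochner_Integration.integral_add) (auto simp: emeasure_eq_measure prob_space)
        finally show ?case using elim by (simp add: dist_real_def)
      qed
    qed
    from tendsto_add[OF diff lim] show "(\<lambda>k. integral\<^sup>L (distr M borel (X k)) ?f)
        \<longlonglongrightarrow> integral\<^sup>L (distr \<mu> borel g) ?f"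
      by (simp add: integral_distr)
  qed
qed

end

subsection \<open>The normal limit of symmetric binomial variables\<close>

lemma measure_std_normal_Ioc_pos:
  assumes "x < y"
  shows "0 < measure std_normal_distribution {x<..y}"
proof -
  interpret real_distribution std_normal_distribution by (rule real_dist_normal_dist)
  have "emeasure std_normal_distribution {x<..y} \<noteq> 0"
  proof
    assume "emeasure std_normal_distribution {x<..y} = 0"
    then have "{x<..y} \<in> null_sets std_normal_distribution" by (auto simp: null_sets_def)
    then have "AE z in lborel. z \<in> {x<..y} \<longrightarrow> std_normal_density z = 0"
      by (subst (asm) null_sets_density_iff) auto
    then have "AE z in lborel. z \<notin> {x<..y}"
      by eventually_elim (metis normal_density_pos less_irrefl zero_less_one)
    then have "emeasure lborel {x<..y} = 0"
      by (subst (asm) AE_iff_measurable[of "{x<..y}"]) auto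
    then show False using assms by simp
  qed
  then show ?thesis by (simp add: emeasure_eq_measure zero_less_measure_iff)
qed

text \<open>A positive density leaves no flat stretch. The cdf therefore exceeds \<open>p\<close>
  strictly to the right of the quantile, on which the convergence of the binomial quantiles
  relies.\<close>

lemma cdf_std_normal_strict_mono:
  assumes "x < y"
  shows "cdf std_normal_distribution x < cdf std_normal_distribution y"
proof -
  interpret real_distribution std_normal_distribution by (rule real_dist_normal_dist)
  show ?thesis using cdf_diff_eq[OF assms] measure_std_normal_Ioc_pos[OF assms] by simp
qed

lemma isCont_cdf_std_normal: "isCont (cdf std_normal_distribution) x"
proof -
  interpret real_distribution std_normal_distribution by (rule real_dist_normal_dist)
  have "AE z in lborel. z \<in> {x} \<longrightarrow> ennreal (std_normal_density z) = 0"
    using AE_lborel_singleton[of x] by eventually_elim simp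
  then have "{x} \<in> null_sets std_normal_distribution"
    by (intro null_sets_density_iff[THEN iffD2] conjI) (assumption | simp)+
  then show ?thesis unfolding isCont_cdf by (simp add: measure_def null_sets_def)
qed

lemma less_normal_quantile_imp:
  assumes "0 < p" "x < normal_quantile p"
  shows "cdf std_normal_distribution x < p"
proof (rule ccontr)
  interpret real_distribution std_normal_distribution by (rule real_dist_normal_dist)
  assume "\<not> cdf std_normal_distribution x < p"
  then have "x \<in> {x. p \<le> cdf std_normal_distribution x}" by simp
  \<comment> \<open>\<open>Inf\<close> is informative only for a set bounded below;
    \<open>0 < p\<close> ensures this through the limit of the cdf at minus infinity.\<close>
  moreover have "bdd_below {x. p \<le> cdf std_normal_distribution x}"
  proof -
    obtain a where a: "cdf std_normal_distribution a < p"
      using eventually_happens[OF order_tendstoD(2)[OF cdf_lim_at_bot \<open>0 < p\<close>]] by auto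
    have "a \<le> x" if "p \<le> cdf std_normal_distribution x" for x
      using cdf_nondecreasing[of x a] a that by linarith
    then show ?thesis by (intro bdd_belowI[where m = a]) simp
  qed
  ultimately have "normal_quantile p \<le> x" unfolding normal_quantile_def by (rule cInf_lower)
  with assms(2) show False by simp
qed

lemma normal_quantile_less_imp:
  assumes "p < 1" "normal_quantile p < x"
  shows "p < cdf std_normal_distribution x"
proof -
  interpret real_distribution std_normal_distribution by (rule real_dist_normal_dist)
  have "{x. p \<le> cdf std_normal_distribution x} \<noteq> {}"
    using eventually_happens[OF order_tendstoD(1)[OF cdf_lim_at_top_prob \<open>p < 1\<close>]]
    by (auto intro: less_imp_le)
  then obtain y where "p \<le> cdf std_normal_distribution y" "y < x"
    using cInf_lessD[OF _ assms(2)[unfolded normal_quantile_def]] by auto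
  with cdf_std_normal_strict_mono[of y x] show ?thesis by simp
qed

section \<open>The de Moivre--Laplace theorem by characteristic functions\<close>

lemma tendsto_cos_power:
  "(\<lambda>n. cos (t / sqrt (real n)) ^ n) \<longlonglongrightarrow> exp (- (t\<^sup>2) / 2)"
proof -
  \<comment> \<open>The asymptotic expansion is made for a fixed sign of \<open>t\<close>; negative
    \<open>t\<close> follow because the cosine is even.\<close>
  have pos: "(\<lambda>n. cos (t / sqrt (real n)) ^ n) \<longlonglongrightarrow> exp (- (t\<^sup>2) / 2)" if "0 < t" for t :: real
    using that by real_asymp (simp add: power2_eq_square)
  consider "0 < t" | "t = 0" | "0 < - t" by linarith
  then show ?thesis
    using pos[of t] pos[of "- t"] by cases auto
qed

lemma integral_binomial_half:
  fixes f :: "nat \<Rightarrow> complex"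
  shows "(\<integral>y. f y \<partial>measure_pmf (binomial_pmf n (1 / 2))) = (\<Sum>y\<le>n. of_nat (n choose y) / 2 ^ n * f y)"
proof -
  have "(\<integral>y. f y \<partial>measure_pmf (binomial_pmf n (1 / 2)))
      = (\<Sum>y\<le>n. pmf (binomial_pmf n (1 / 2)) y *\<^sub>R f y)"
    by (rule integral_measure_pmf) (use set_pmf_binomial_eq[of "1/2" n] in auto)
  also have "\<dots> = (\<Sum>y\<le>n. of_nat (n choose y) / 2 ^ n * f y)"
  proof (rule sum.cong)
    fix y assume "y \<in> {..n}"
    then have "(1 / 2) ^ y * (1 / 2) ^ (n - y) = (1 / 2 :: real) ^ n"
      by (simp flip: power_add)
    then have "pmf (binomial_pmf n (1 / 2)) y = real (n choose y) / 2 ^ n"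
      by (simp add: power_one_over mult.assoc)
    then show "pmf (binomial_pmf n (1 / 2)) y *\<^sub>R f y = of_nat (n choose y) / 2 ^ n * f y"
      by (simp add: scaleR_conv_of_real)
  qed simp
  finally show ?thesis .
qed

text \<open>The usual standardisation (for positive \<open>n\<close>) with the sign reversed: the
  upper tail that defines \<open>ghulc_c\<close> becomes a lower tail, hence a value of the cdf. The
  variable \<open>G\<close> of the final proof has the same form.\<close>

definition centered_binomial :: "nat \<Rightarrow> real measure" where
  "centered_binomial n =
     distr (measure_pmf (binomial_pmf n (1 / 2))) borel (\<lambda>y. (real n - 2 * real y) / sqrt (real n))"

text \<open>With \<open>u = t / sqrt n\<close> the expectation is the binomial expansion of the
  \<open>n\<close>-th power of \<open>(iexp (- u) + iexp u) / 2\<close>, which is Euler's formula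
  for the cosine.\<close>

lemma char_centered_binomial: "char (centered_binomial n) t = cos (t / sqrt (real n)) ^ n"
proof -
  define u where "u = t / sqrt (real n)"
  have "char (centered_binomial n) t
      = (\<integral>y. iexp (t * ((real n - 2 * real y) / sqrt (real n))) \<partial>measure_pmf (binomial_pmf n (1 / 2)))"
    unfolding char_def centered_binomial_def by (subst integral_distr) auto
  also have "\<dots> = (\<Sum>y\<le>n. of_nat (n choose y) / 2 ^ n * iexp (t * ((real n - 2 * real y) / sqrt (real n))))"
    by (rule integral_binomial_half)
  also have "\<dots> = (\<Sum>y\<le>n. of_nat (n choose y) * iexp (- u) ^ y * iexp u ^ (n - y)) / 2 ^ n"
    unfolding sum_divide_distrib
  proof (rule sum.cong)
    fix y assume "y \<in> {..n}"
    then have "real y * (- u) + real (n - y) * u = t * ((real n - 2 * real y) / sqrt (real n))"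
      unfolding u_def by (cases "n = 0") (auto simp: of_nat_diff field_simps)
    moreover have pow: "iexp v ^ m = iexp (real m * v)" for v m
      by (subst exp_of_nat_mult[symmetric]) (simp add: mult_ac)
    moreover have "iexp v * iexp w = iexp (v + w)" for v w :: real
      by (simp add: exp_add distrib_left)
    ultimately have "iexp (- u) ^ y * iexp u ^ (n - y) = iexp (t * ((real n - 2 * real y) / sqrt (real n)))"
      by (simp only: pow)
    then show "of_nat (n choose y) / 2 ^ n * iexp (t * ((real n - 2 * real y) / sqrt (real n)))
        = of_nat (n choose y) * iexp (- u) ^ y * iexp u ^ (n - y) / 2 ^ n"
      by (simp add: mult.assoc)
  qed simp
  also have "\<dots> = ((iexp (- u) + iexp u) / 2) ^ n"
    by (simp add: binomial_ring power_divide)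
  also have "(iexp (- u) + iexp u) / 2 = cos u"
    by (simp add: cos_exp_eq add.commute flip: cos_of_real)
  finally show ?thesis by (simp add: u_def)
qed

lemma real_distribution_centered_binomial: "real_distribution (centered_binomial n)"
  unfolding centered_binomial_def by (rule prob_space.real_distribution_distr[OF prob_space_measure_pmf]) simp

lemma de_Moivre_Laplace: "weak_conv_m centered_binomial std_normal_distribution"
proof (rule levy_continuity)
  fix t
  have "(\<lambda>n. complex_of_real (cos (t / sqrt (real n)) ^ n)) \<longlonglongrightarrow> complex_of_real (exp (- (t\<^sup>2) / 2))"
    by (intro tendsto_of_real tendsto_cos_power)
  then show "(\<lambda>n. char (centered_binomial n) t) \<longlonglongrightarrow> char std_normal_distribution t"
    by (simp add: char_centered_binomial char_std_normal_distribution)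
qed (rule real_distribution_centered_binomial, rule real_dist_normal_dist)

section \<open>The limit of the GHulC index\<close>

lemma Least_intE:
  fixes Q :: "int \<Rightarrow> bool"
  assumes "\<exists>x. Q x" and bound: "\<And>x. Q x \<Longrightarrow> l \<le> x"
  shows "Q (LEAST x. Q x) \<and> \<not> Q ((LEAST x. Q x) - 1)"
proof -
  obtain x where "Q x" using assms(1) by blast
  \<comment> \<open>The integers are not well-ordered, so the minimum is taken over the natural
    distances from the lower bound \<open>l\<close>.\<close>
  define m where "m = (LEAST m::nat. Q (l + int m))"
  have ex: "Q (l + int (nat (x - l)))" using \<open>Q x\<close> bound[OF \<open>Q x\<close>] by simp
  then have m: "Q (l + int m)" unfolding m_def by (rule LeastI)
  have min: "l + int m \<le> y" if "Q y" for y
  proof -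
    have "Q (l + int (nat (y - l)))" using that bound[OF that] by simp
    then have "m \<le> nat (y - l)" unfolding m_def by (rule Least_le)
    then show ?thesis using bound[OF that] by linarith
  qed
  have "(LEAST x. Q x) = l + int m" using m min by (intro Least_equality) auto
  with m min show ?thesis by fastforce
qed

lemma prob_binomial_eq_cdf_centered:
  assumes "0 < n"
  shows "measure_pmf.prob (binomial_pmf n (1 / 2)) {y. int y \<ge> \<lfloor>real n / 2\<rfloor> - x}
    = cdf (centered_binomial n) ((real n - 2 * \<lfloor>real n / 2\<rfloor> + 2 * x) / sqrt (real n))"
proof -
  have "int y \<ge> \<lfloor>real n / 2\<rfloor> - x \<longleftrightarrow>
      (real n - 2 * real y) / sqrt (real n) \<le> (real n - 2 * \<lfloor>real n / 2\<rfloor> + 2 * x) / sqrt (real n)" for y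
  proof -
    have "int y \<ge> \<lfloor>real n / 2\<rfloor> - x \<longleftrightarrow> real_of_int (int y) \<ge> real_of_int (\<lfloor>real n / 2\<rfloor> - x)"
      by (simp only: of_int_le_iff)
    also have "\<dots> \<longleftrightarrow> real n - 2 * real y \<le> real n - 2 * \<lfloor>real n / 2\<rfloor> + 2 * x" by auto
    finally show ?thesis using assms by (simp add: divide_le_cancel)
  qed
  then show ?thesis
    by (simp add: cdf_def centered_binomial_def measure_distr vimage_def)
qed

text \<open>Lowering the index by 1 shifts the argument of the cdf by \<open>2 / sqrt n\<close>. By
  minimality of \<open>ghulc_c\<close> the cdf of \<open>centered_binomial n\<close> thus passes
  \<open>1 - \<alpha> / 2\<close> between \<open>q n - 2 / sqrt n\<close> and \<open>q n\<close>,
  and convergence to a strictly increasing continuous cdf drives these points to the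
  quantile.\<close>

lemma tendsto_ghulc_c:
  assumes "0 < \<alpha>" "\<alpha> < 1"
  shows "(\<lambda>n. 2 * real_of_int (ghulc_c n \<alpha>) / sqrt (real n)) \<longlonglongrightarrow> normal_quantile (1 - \<alpha> / 2)"
proof -
  define p where "p = 1 - \<alpha> / 2"
  have p: "0 < p" "p < 1" using assms by (auto simp: p_def)
  \<comment> \<open>The parity of \<open>n\<close>, which disappears after division by
    \<open>sqrt n\<close>.\<close>
  define d where "d n = real n - 2 * \<lfloor>real n / 2\<rfloor>" for n
  have d: "0 \<le> d n" "d n \<le> 2" for n unfolding d_def by linarith+
  define q where "q n = (d n + 2 * real_of_int (ghulc_c n \<alpha>)) / sqrt (real n)" for n
  have c: "p \<le> cdf (centered_binomial n) (q n)"
      "cdf (centered_binomial n) (q n - 2 / sqrt (real n)) < p" if "0 < n" for n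
  proof -
    let ?Q = "\<lambda>x. p \<le> measure_pmf.prob (binomial_pmf n (1 / 2)) {y. int y \<ge> \<lfloor>real n / 2\<rfloor> - x}"
    \<comment> \<open>Existence and lower bound of admissible indices: here the event is certain,
      and for \<open>x\<close> below the bound that follows it contains no value of the binomial
      variable.\<close>
    have "?Q \<lfloor>real n / 2\<rfloor>" using p by simp
    moreover have "\<lfloor>real n / 2\<rfloor> - int n \<le> x" if "?Q x" for x
    proof (rule ccontr)
      assume "\<not> \<lfloor>real n / 2\<rfloor> - int n \<le> x"
      then have "{y. int y \<ge> \<lfloor>real n / 2\<rfloor> - x} \<inter> set_pmf (binomial_pmf n (1 / 2)) = {}"
        by (auto simp: set_pmf_binomial_eq)
      then have "measure_pmf.prob (binomial_pmf n (1 / 2)) {y. int y \<ge> \<lfloor>real n / 2\<rfloor> - x} = 0"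
        by (simp add: measure_pmf_zero_iff Int_commute)
      with that p show False by simp
    qed
    ultimately have "?Q (LEAST x. ?Q x) \<and> \<not> ?Q ((LEAST x. ?Q x) - 1)"
      by (intro Least_intE) blast+
    moreover have "(LEAST x. ?Q x) = ghulc_c n \<alpha>" by (simp add: ghulc_c_def p_def)
    ultimately have "?Q (ghulc_c n \<alpha>) \<and> \<not> ?Q (ghulc_c n \<alpha> - 1)" by simp
    then show "p \<le> cdf (centered_binomial n) (q n)"
        "cdf (centered_binomial n) (q n - 2 / sqrt (real n)) < p"
      unfolding prob_binomial_eq_cdf_centered[OF that] q_def d_def
      by (simp_all add: not_le add_diff_eq flip: diff_divide_distrib)
  qed
  have conv: "(\<lambda>n. cdf (centered_binomial n) x) \<longlonglongrightarrow> cdf std_normal_distribution x" for x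
    using de_Moivre_Laplace isCont_cdf_std_normal by (simp add: weak_conv_m_def weak_conv_def)
  have mono: "x \<le> y \<Longrightarrow> cdf (centered_binomial n) x \<le> cdf (centered_binomial n) y" for n x y
  proof -
    interpret real_distribution "centered_binomial n" by (rule real_distribution_centered_binomial)
    show "x \<le> y \<Longrightarrow> cdf (centered_binomial n) x \<le> cdf (centered_binomial n) y"
      by (rule cdf_nondecreasing)
  qed
  have bound_lim: "(\<lambda>n. 2 / sqrt (real n)) \<longlonglongrightarrow> 0" by real_asymp
  have "q \<longlonglongrightarrow> normal_quantile p"
  proof (rule order_tendstoI)
    fix a assume "a < normal_quantile p"
    from order_tendstoD(2)[OF conv less_normal_quantile_imp[OF p(1) this]] eventually_gt_at_top[of 0]
    show "\<forall>\<^sub>F n in sequentially. a < q n"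
    proof eventually_elim
      case (elim n)
      then show ?case using c(1)[of n] mono[of "q n" a n] by linarith
    qed
  next
    fix a assume a: "normal_quantile p < a"
    \<comment> \<open>The midpoint leaves room for the shift by \<open>2 / sqrt n\<close>.\<close>
    define a' where "a' = (normal_quantile p + a) / 2"
    have a': "normal_quantile p < a'" "0 < a - a'" using a by (auto simp: a'_def)
    from order_tendstoD(1)[OF conv normal_quantile_less_imp[OF p(2) a'(1)]]
      eventually_gt_at_top[of 0] order_tendstoD(2)[OF bound_lim a'(2)]
    show "\<forall>\<^sub>F n in sequentially. q n < a"
    proof eventually_elim
      case (elim n)
      then show ?case using c(2)[of n] mono[of a' "q n - 2 / sqrt (real n)" n] by linarith
    qed
  qed
  moreover have "(\<lambda>n. d n / sqrt (real n)) \<longlonglongrightarrow> 0"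
  proof (rule Lim_null_comparison[OF always_eventually bound_lim], rule allI)
    show "norm (d n / sqrt (real n)) \<le> 2 / sqrt (real n)" for n
      using d[of n] by (simp add: divide_right_mono)
  qed
  ultimately have "(\<lambda>n. q n - d n / sqrt (real n)) \<longlonglongrightarrow> normal_quantile p - 0"
    by (rule tendsto_diff)
  then show ?thesis by (simp add: q_def p_def add_divide_distrib)
qed

subsection \<open>Sums of independent bounded variables\<close>

context prob_space
begin

text \<open>
  The characteristic function of each summand differs from \<open>cos (t / sqrt B)\<close> by at most twice the
  bias, so that of the sum differs from \<open>cos (t / sqrt B) ^ B\<close> by at most \<open>2 * B * e\<close>.
\<close>

lemma weak_conv_bernoulli_sum:
  fixes I :: "nat \<Rightarrow> nat \<Rightarrow> 'a \<Rightarrow> real" and B :: "nat \<Rightarrow> nat"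
  assumes indep: "\<And>k. indep_vars (\<lambda>_. borel) (I k) {..<B k}"
    and zero_one: "\<And>k j \<omega>. I k j \<omega> = 0 \<or> I k j \<omega> = 1"
    and bias: "\<forall>\<^sub>F k in sequentially. \<forall>j<B k. \<bar>expectation (I k j) - 1 / 2\<bar> \<le> e k"
    and bias_lim: "(\<lambda>k. real (B k) * e k) \<longlonglongrightarrow> 0"
    and B_lim: "filterlim B at_top sequentially"
  shows "weak_conv_m (\<lambda>k. distr M borel (\<lambda>\<omega>. (real (B k) - 2 * (\<Sum>j<B k. I k j \<omega>)) / sqrt (real (B k))))
    std_normal_distribution"
proof (rule levy_continuity)
  have meas [measurable]: "j < B k \<Longrightarrow> random_variable borel (I k j)" for k j
    using indep[of k] by (simp add: indep_vars_def2)
  show "real_distribution (distr M borel (\<lambda>\<omega>. (real (B k) - 2 * (\<Sum>j<B k. I k j \<omega>)) / sqrt (real (B k))))" for k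
    by (rule real_distribution_distr) measurable
  show "real_distribution std_normal_distribution" by (rule real_dist_normal_dist)
  fix t :: real
  define u where "u k = t / sqrt (real (B k))" for k
  define \<phi> where "\<phi> k j = char (distr M borel (\<lambda>\<omega>. (1 - 2 * I k j \<omega>) / sqrt (real (B k)))) t" for k j
  have char_eq: "char (distr M borel (\<lambda>\<omega>. (real (B k) - 2 * (\<Sum>j<B k. I k j \<omega>)) / sqrt (real (B k)))) t
      = (\<Prod>j<B k. \<phi> k j)" for k
  proof -
    have "(real (B k) - 2 * (\<Sum>j<B k. I k j \<omega>)) / sqrt (real (B k))
        = (\<Sum>j<B k. (1 - 2 * I k j \<omega>) / sqrt (real (B k)))" for \<omega>
      by (simp add: sum_subtractf sum_distrib_left flip: sum_divide_distrib)
    moreover have "indep_vars (\<lambda>_. borel) (\<lambda>j \<omega>. (1 - 2 * I k j \<omega>) / sqrt (real (B k))) {..<B k}"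
      by (rule indep_vars_compose2[OF indep]) measurable
    ultimately show ?thesis unfolding \<phi>_def by (simp add: char_distr_sum)
  qed
  have \<phi>_bound: "norm (\<phi> k j) \<le> 1" if "j < B k" for k j
  proof -
    interpret N: real_distribution "distr M borel (\<lambda>\<omega>. (1 - 2 * I k j \<omega>) / sqrt (real (B k)))"
      using that by (intro real_distribution_distr) measurable
    show ?thesis unfolding \<phi>_def by (rule N.cmod_char_le_1)
  qed
  have \<phi>_diff: "norm (\<phi> k j - complex_of_real (cos (u k))) \<le> 2 * \<bar>expectation (I k j) - 1 / 2\<bar>"
    if "j < B k" for k j
  proof -
    have int: "integrable M (I k j)"
    proof (rule integrable_const_bound[where B = 1])
      have "norm (I k j \<omega>) \<le> 1" for \<omega> using zero_one[of k j \<omega>] by auto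
      then show "AE \<omega> in M. norm (I k j \<omega>) \<le> 1" by simp
    qed (rule meas[OF that])
    have "\<phi> k j = (CLINT \<omega>|M. iexp (t * ((1 - 2 * I k j \<omega>) / sqrt (real (B k)))))"
      unfolding \<phi>_def char_def using that by (subst integral_distr) auto
    \<comment> \<open>On the values 0 and 1 the exponential is an affine function of
      \<open>I k j\<close>, so its integral depends only on the expectation of
      \<open>I k j\<close>.\<close>
    also have "\<dots> = (CLINT \<omega>|M. iexp (u k) + complex_of_real (I k j \<omega>) * (iexp (- u k) - iexp (u k)))"
    proof (rule Bochner_Integration.integral_cong)
      show "iexp (t * ((1 - 2 * I k j \<omega>) / sqrt (real (B k))))
          = iexp (u k) + complex_of_real (I k j \<omega>) * (iexp (- u k) - iexp (u k))" for \<omega>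
        using zero_one[of k j \<omega>] by (auto simp: u_def)
    qed simp
    also have "\<dots> = iexp (u k) + complex_of_real (expectation (I k j)) * (iexp (- u k) - iexp (u k))"
      using int by (simp add: prob_space)
    finally have \<phi>: "\<phi> k j = iexp (u k) + complex_of_real (expectation (I k j)) * (iexp (- u k) - iexp (u k))" .
    have cos: "complex_of_real (cos (u k)) = (iexp (- u k) + iexp (u k)) / 2"
      by (simp add: cos_exp_eq add.commute flip: cos_of_real)
    have "\<phi> k j - complex_of_real (cos (u k))
        = complex_of_real (expectation (I k j) - 1 / 2) * (iexp (- u k) - iexp (u k))"
      unfolding \<phi> cos by (simp add: field_simps)
    then have "norm (\<phi> k j - complex_of_real (cos (u k)))
        = \<bar>expectation (I k j) - 1 / 2\<bar> * norm (iexp (- u k) - iexp (u k))"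
      by (simp only: norm_mult norm_of_real)
    also have "\<dots> \<le> \<bar>expectation (I k j) - 1 / 2\<bar> * 2"
      using norm_triangle_ineq4[of "iexp (- u k)" "iexp (u k)"] by (intro mult_left_mono) auto
    finally show ?thesis by (simp only: mult.commute)
  qed
  have "(\<lambda>k. (\<Prod>j<B k. \<phi> k j) - complex_of_real (cos (u k)) ^ B k) \<longlonglongrightarrow> 0"
  proof (rule Lim_null_comparison)
    show "(\<lambda>k. 2 * (real (B k) * e k)) \<longlonglongrightarrow> 0" by (intro tendsto_mult_right_zero bias_lim)
    show "\<forall>\<^sub>F k in sequentially. norm ((\<Prod>j<B k. \<phi> k j) - complex_of_real (cos (u k)) ^ B k)
        \<le> 2 * (real (B k) * e k)"
      using bias
    proof eventually_elim
      case (elim k)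
      \<comment> \<open>For factors of norm at most 1, telescoping bounds the difference of two
        products by the sum of the differences of the factors.\<close>
      have "norm ((\<Prod>j<B k. \<phi> k j) - (\<Prod>j<B k. complex_of_real (cos (u k))))
          \<le> (\<Sum>j<B k. norm (\<phi> k j - complex_of_real (cos (u k))))"
        by (rule norm_prod_diff) (auto simp: \<phi>_bound)
      also have "\<dots> \<le> (\<Sum>j<B k. 2 * e k)"
        using elim by (intro sum_mono order_trans[OF \<phi>_diff]) auto
      finally show ?case by simp
    qed
  qed
  moreover have "(\<lambda>k. complex_of_real (cos (u k)) ^ B k) \<longlonglongrightarrow> complex_of_real (exp (- (t\<^sup>2) / 2))"
    using tendsto_of_real[OF filterlim_compose[OF tendsto_cos_power[of t] B_lim], where 'a = complex]
    by (simp add: u_def)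
  ultimately have "(\<lambda>k. ((\<Prod>j<B k. \<phi> k j) - complex_of_real (cos (u k)) ^ B k) + complex_of_real (cos (u k)) ^ B k)
      \<longlonglongrightarrow> 0 + complex_of_real (exp (- (t\<^sup>2) / 2))"
    by (rule tendsto_add)
  then show "(\<lambda>k. char (distr M borel (\<lambda>\<omega>. (real (B k) - 2 * (\<Sum>j<B k. I k j \<omega>)) / sqrt (real (B k)))) t)
      \<longlonglongrightarrow> char std_normal_distribution t"
    by (simp add: char_eq char_std_normal_distribution)
qed

lemma second_moment_indep_sum:
  fixes Z :: "'b \<Rightarrow> 'a \<Rightarrow> real"
  assumes indep: "indep_vars (\<lambda>_. borel) Z J" and "finite J"
    and bound: "\<And>j \<omega>. \<bar>Z j \<omega>\<bar> \<le> c" and mean: "\<And>j. j \<in> J \<Longrightarrow> expectation (Z j) = 0"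
  shows "expectation (\<lambda>\<omega>. (\<Sum>j\<in>J. Z j \<omega>)\<^sup>2) = (\<Sum>j\<in>J. expectation (\<lambda>\<omega>. (Z j \<omega>)\<^sup>2))"
proof -
  have meas [measurable]: "j \<in> J \<Longrightarrow> random_variable borel (Z j)" for j
    using indep by (simp add: indep_vars_def2)
  have int: "integrable M (Z j)" if "j \<in> J" for j
    using that bound by (intro integrable_const_bound[where B = c]) auto
  have int2: "integrable M (\<lambda>\<omega>. Z i \<omega> * Z j \<omega>)" if "i \<in> J" "j \<in> J" for i j
  proof (rule integrable_const_bound[where B = "c * c"])
    have "\<bar>Z i \<omega> * Z j \<omega>\<bar> \<le> c * c" for \<omega>
      unfolding abs_mult using bound[of i \<omega>] bound[of j \<omega>] by (intro mult_mono) auto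
    then show "AE \<omega> in M. norm (Z i \<omega> * Z j \<omega>) \<le> c * c" by simp
  qed (use that in measurable)
  have cross: "expectation (\<lambda>\<omega>. Z i \<omega> * Z j \<omega>) = 0" if "i \<in> J" "j \<in> J" "i \<noteq> j" for i j
  proof -
    have "expectation (\<lambda>\<omega>. \<Prod>l\<in>{i, j}. Z l \<omega>) = (\<Prod>l\<in>{i, j}. expectation (Z l))"
      using that by (intro indep_vars_lebesgue_integral indep_vars_subset[OF indep]) (auto intro: int)
    then show ?thesis using that mean by simp
  qed
  have "expectation (\<lambda>\<omega>. (\<Sum>j\<in>J. Z j \<omega>)\<^sup>2) = (\<Sum>i\<in>J. \<Sum>j\<in>J. expectation (\<lambda>\<omega>. Z i \<omega> * Z j \<omega>))"
    by (simp add: power2_eq_square sum_product int2)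
  also have "\<dots> = (\<Sum>i\<in>J. \<Sum>j\<in>J. if j = i then expectation (\<lambda>\<omega>. (Z i \<omega>)\<^sup>2) else 0)"
    by (intro sum.cong refl) (auto simp: cross power2_eq_square)
  also have "\<dots> = (\<Sum>i\<in>J. expectation (\<lambda>\<omega>. (Z i \<omega>)\<^sup>2))"
    using \<open>finite J\<close> by simp
  finally show ?thesis .
qed

text \<open>Values bounded by 1 have squares below their absolute values, and first absolute moments
  are what the expansion of the distribution functions controls.\<close>

lemma variance_indep_sum_le:
  fixes Y :: "'b \<Rightarrow> 'a \<Rightarrow> real"
  assumes indep: "indep_vars (\<lambda>_. borel) Y J" and "finite J"
    and bound: "\<And>j \<omega>. \<bar>Y j \<omega>\<bar> \<le> 1"
  shows "variance (\<lambda>\<omega>. \<Sum>j\<in>J. Y j \<omega>) \<le> (\<Sum>j\<in>J. expectation (\<lambda>\<omega>. \<bar>Y j \<omega>\<bar>))"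
proof -
  have meas [measurable]: "j \<in> J \<Longrightarrow> random_variable borel (Y j)" for j
    using indep by (simp add: indep_vars_def2)
  have int: "integrable M (Y j)" if "j \<in> J" for j
    using that bound by (intro integrable_const_bound[where B = 1]) auto
  have sq: "(Y j \<omega>)\<^sup>2 \<le> \<bar>Y j \<omega>\<bar>" for j \<omega>
    using mult_left_le[OF bound[of j \<omega>] abs_ge_zero[of "Y j \<omega>"]] by (simp add: power2_eq_square)
  have int2: "integrable M (\<lambda>\<omega>. (Y j \<omega>)\<^sup>2)" if "j \<in> J" for j
    using that order_trans[OF sq bound] by (intro integrable_const_bound[where B = 1]) auto
  define Z where "Z j \<omega> = Y j \<omega> - expectation (Y j)" for j \<omega>
  \<comment> \<open>The bound on \<open>Z\<close> is asked for every \<open>j\<close>. Outside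
    \<open>J\<close> the function may fail to be integrable; its integral is then 0 by
    convention.\<close>
  have mean_bound: "\<bar>expectation (Y j)\<bar> \<le> 1" for j
  proof (cases "integrable M (Y j)")
    case True
    have "\<bar>expectation (Y j)\<bar> \<le> expectation (\<lambda>\<omega>. \<bar>Y j \<omega>\<bar>)" by (rule integral_abs_bound)
    also have "\<dots> \<le> expectation (\<lambda>\<omega>. 1)"
      using True bound by (intro integral_mono) auto
    finally show ?thesis by (simp add: prob_space)
  qed (simp add: not_integrable_integral_eq)
  have "variance (\<lambda>\<omega>. \<Sum>j\<in>J. Y j \<omega>) = expectation (\<lambda>\<omega>. (\<Sum>j\<in>J. Z j \<omega>)\<^sup>2)"
    by (simp add: Z_def sum_subtractf int)
  also have "\<dots> = (\<Sum>j\<in>J. expectation (\<lambda>\<omega>. (Z j \<omega>)\<^sup>2))"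
  proof (rule second_moment_indep_sum[where c = 2])
    show "indep_vars (\<lambda>_. borel) Z J"
      unfolding Z_def by (rule indep_vars_compose2[OF indep]) measurable
    show "\<bar>Z j \<omega>\<bar> \<le> 2" for j \<omega>
      using bound[of j \<omega>] mean_bound[of j] unfolding Z_def by linarith
    show "expectation (Z j) = 0" if "j \<in> J" for j
      using int[OF that] by (simp add: Z_def[abs_def] prob_space)
  qed fact
  also have "\<dots> \<le> (\<Sum>j\<in>J. expectation (\<lambda>\<omega>. \<bar>Y j \<omega>\<bar>))"
  proof (rule sum_mono)
    fix j assume "j \<in> J"
    have "expectation (\<lambda>\<omega>. (Z j \<omega>)\<^sup>2) = expectation (\<lambda>\<omega>. (Y j \<omega>)\<^sup>2) - (expectation (Y j))\<^sup>2"
      unfolding Z_def by (rule variance_eq) (use \<open>j \<in> J\<close> int int2 in auto)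
    also have "\<dots> \<le> expectation (\<lambda>\<omega>. (Y j \<omega>)\<^sup>2)" by simp
    also have "\<dots> \<le> expectation (\<lambda>\<omega>. \<bar>Y j \<omega>\<bar>)"
      using \<open>j \<in> J\<close> int int2 sq by (intro integral_mono) auto
    finally show "expectation (\<lambda>\<omega>. (Z j \<omega>)\<^sup>2) \<le> expectation (\<lambda>\<omega>. \<bar>Y j \<omega>\<bar>)" .
  qed
  finally show ?thesis .
qed

text \<open>After division by \<open>sqrt B\<close> the variance is at most the average of the first
  absolute moments. It vanishes even if the means add up to order \<open>sqrt B\<close>, which is
  how a nonzero limit \<open>h\<close> arises.\<close>

lemma null_in_probability_indep_sum:
  fixes Y :: "nat \<Rightarrow> nat \<Rightarrow> 'a \<Rightarrow> real" and B :: "nat \<Rightarrow> nat"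
  assumes indep: "\<And>k. indep_vars (\<lambda>_. borel) (Y k) {..<B k}"
    and bound: "\<And>k j \<omega>. \<bar>Y k j \<omega>\<bar> \<le> 1"
    and mean: "(\<lambda>k. (\<Sum>j<B k. expectation (Y k j)) / sqrt (real (B k))) \<longlonglongrightarrow> h"
    and abs_mean: "(\<lambda>k. (\<Sum>j<B k. expectation (\<lambda>\<omega>. \<bar>Y k j \<omega>\<bar>)) / real (B k)) \<longlonglongrightarrow> 0"
    and B_pos: "\<forall>\<^sub>F k in sequentially. 0 < B k"
  shows "null_in_probability M (\<lambda>k \<omega>. (\<Sum>j<B k. Y k j \<omega>) / sqrt (real (B k)) - h)"
  unfolding null_in_probability_def
proof (intro allI impI)
  fix \<epsilon> :: real assume "0 < \<epsilon>"
  have meas [measurable]: "j < B k \<Longrightarrow> random_variable borel (Y k j)" for k j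
    using indep[of k] by (simp add: indep_vars_def2)
  have int: "integrable M (Y k j)" if "j < B k" for k j
    using that bound by (intro integrable_const_bound[where B = 1]) auto
  let ?S = "\<lambda>k \<omega>. \<Sum>j<B k. Y k j \<omega>"
  let ?v = "\<lambda>k. (\<Sum>j<B k. expectation (\<lambda>\<omega>. \<bar>Y k j \<omega>\<bar>)) / real (B k)"
  show "(\<lambda>k. prob {\<omega> \<in> space M. \<epsilon> < \<bar>?S k \<omega> / sqrt (real (B k)) - h\<bar>}) \<longlonglongrightarrow> 0"
  proof (rule Lim_null_comparison)
    \<comment> \<open>Half of \<epsilon> is spent on the distance between the normalised mean and
      \<open>h\<close>, so Chebyshev's inequality is applied with \<open>\<epsilon> / 2\<close>;
      hence the factor 4.\<close>
    show "(\<lambda>k. 4 / \<epsilon>\<^sup>2 * ?v k) \<longlonglongrightarrow> 0" by (intro tendsto_mult_right_zero abs_mean)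
    have "\<forall>\<^sub>F k in sequentially. dist ((\<Sum>j<B k. expectation (Y k j)) / sqrt (real (B k))) h < \<epsilon> / 2"
      using mean \<open>0 < \<epsilon>\<close> by (intro tendstoD) auto
    then show "\<forall>\<^sub>F k in sequentially.
        norm (prob {\<omega> \<in> space M. \<epsilon> < \<bar>?S k \<omega> / sqrt (real (B k)) - h\<bar>}) \<le> 4 / \<epsilon>\<^sup>2 * ?v k"
      using B_pos
    proof eventually_elim
      case (elim k)
      define b where "b = sqrt (real (B k))"
      have "0 < b" using elim(2) by (simp add: b_def)
      have mean_eq: "expectation (?S k) = (\<Sum>j<B k. expectation (Y k j))"
        by (rule Bochner_Integration.integral_sum) (simp add: int)
      have "\<bar>?S k \<omega>\<bar> \<le> real (B k)" for \<omega>
        using order_trans[OF sum_abs[of "\<lambda>j. Y k j \<omega>" "{..<B k}"] sum_bounded_above[of "{..<B k}" _ 1]] bound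
        by simp
      then have sq: "integrable M (\<lambda>\<omega>. (?S k \<omega>)\<^sup>2)"
        by (intro integrable_const_bound[where B = "(real (B k))\<^sup>2"]) (auto simp: abs_le_square_iff[symmetric])
      have "{\<omega> \<in> space M. \<epsilon> < \<bar>?S k \<omega> / b - h\<bar>}
          \<subseteq> {\<omega> \<in> space M. b * \<epsilon> / 2 \<le> \<bar>?S k \<omega> - expectation (?S k)\<bar>}"
      proof safe
        fix \<omega> assume "\<epsilon> < \<bar>?S k \<omega> / b - h\<bar>"
        with elim(1) have "\<epsilon> / 2 \<le> \<bar>?S k \<omega> / b - expectation (?S k) / b\<bar>"
          unfolding mean_eq b_def dist_real_def by linarith
        also have "\<dots> = \<bar>?S k \<omega> - expectation (?S k)\<bar> / b"
          using \<open>0 < b\<close> by (simp add: abs_div flip: diff_divide_distrib)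
        finally show "b * \<epsilon> / 2 \<le> \<bar>?S k \<omega> - expectation (?S k)\<bar>"
          using \<open>0 < b\<close> by (simp add: field_simps)
      qed
      then have "prob {\<omega> \<in> space M. \<epsilon> < \<bar>?S k \<omega> / b - h\<bar>}
          \<le> prob {\<omega> \<in> space M. b * \<epsilon> / 2 \<le> \<bar>?S k \<omega> - expectation (?S k)\<bar>}"
        by (rule finite_measure_mono) measurable
      also have "\<dots> \<le> variance (?S k) / (b * \<epsilon> / 2)\<^sup>2"
        using sq \<open>0 < b\<close> \<open>0 < \<epsilon>\<close> by (intro Chebyshev_inequality) auto
      also have "\<dots> \<le> (\<Sum>j<B k. expectation (\<lambda>\<omega>. \<bar>Y k j \<omega>\<bar>)) / (b * \<epsilon> / 2)\<^sup>2"
        by (intro divide_right_mono variance_indep_sum_le indep) (auto simp: bound)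
      also have "\<dots> = 4 / \<epsilon>\<^sup>2 * ?v k"
        by (simp add: b_def power_divide power_mult_distrib mult.commute)
      finally show ?case by (simp add: b_def)
    qed
  qed
qed

text \<open>At \<open>x * \<tau>\<close> the main term of the expansion is exactly
  \<open>signed_powr \<rho> x / sqrt B\<close>, so summation over \<open>B\<close> batches and
  division by \<open>sqrt B\<close> leave \<open>signed_powr \<rho> x\<close>.\<close>

lemma null_in_probability_local_count:
  fixes X :: "nat \<Rightarrow> nat \<Rightarrow> 'a \<Rightarrow> real" and F :: "nat \<Rightarrow> nat \<Rightarrow> real \<Rightarrow> real"
    and B :: "nat \<Rightarrow> nat" and m C \<tau> :: "nat \<Rightarrow> real"
  assumes indep: "\<And>k. indep_vars (\<lambda>_. borel) (X k) {..<B k}"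
    and F: "\<And>k j t. j < B k \<Longrightarrow> F k j t = prob {\<omega> \<in> space M. X k j \<omega> \<le> t}"
    and params: "0 < \<rho>" "0 < \<Delta>" "0 < \<eta>" "\<And>k. 0 < m k"
    and expansion: "\<forall>\<^sub>F k in sequentially. \<forall>j<B k. \<forall>t. \<bar>t\<bar> < \<eta> \<longrightarrow>
          \<bar>F k j t - F k j 0 - m k * \<bar>t\<bar> powr \<rho> * sgn t\<bar> \<le> C k * \<bar>t\<bar> powr (\<rho> + \<Delta>)"
    and regime: "local_expansion_regime \<rho> \<Delta> m C B"
    and B_lim: "filterlim B at_top sequentially"
    and \<tau>_def: "\<And>k. \<tau> k = (m k * sqrt (real (B k))) powr (- 1 / \<rho>)"
  shows "null_in_probability M (\<lambda>k \<omega>.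
    (\<Sum>j<B k. indicator {..x * \<tau> k} (X k j \<omega>) - indicator {..0} (X k j \<omega>)) / sqrt (real (B k)) - signed_powr \<rho> x)"
proof -
  define Y :: "nat \<Rightarrow> nat \<Rightarrow> 'a \<Rightarrow> real" where
    "Y k j \<omega> = indicator {..x * \<tau> k} (X k j \<omega>) - indicator {..0} (X k j \<omega>)" for k j \<omega>
  have meas [measurable]: "j < B k \<Longrightarrow> random_variable borel (X k j)" for k j
    using indep[of k] by (simp add: indep_vars_def2)
  define w where "w k = m k * sqrt (real (B k))" for k
  have w_lim: "filterlim w at_top sequentially"
    and rem_lim: "(\<lambda>k. C k / m k * w k powr (- \<Delta> / \<rho>)) \<longlonglongrightarrow> 0"
    using regime unfolding local_expansion_regime_def w_def by blast+
  have \<tau>_lim: "\<tau> \<longlonglongrightarrow> 0"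
    unfolding \<tau>_def w_def[symmetric] using params by (intro tendsto_neg_powr w_lim) auto
  have sqrt_lim: "filterlim (\<lambda>k. sqrt (real (B k))) at_top sequentially"
    by (intro filterlim_compose[OF sqrt_at_top] filterlim_compose[OF filterlim_real_sequentially] B_lim)
  have B_pos: "\<forall>\<^sub>F k in sequentially. 0 < B k"
    by (rule eventually_compose_filterlim[OF eventually_gt_at_top B_lim])
  have ind_mean: "expectation (\<lambda>\<omega>. indicator {..t} (X k j \<omega>)) = F k j t"
    and ind_int: "integrable M (\<lambda>\<omega>. indicator {..t} (X k j \<omega>) :: real)" if "j < B k" for k j t
  proof -
    have eq: "indicator {..t} (X k j \<omega>) = (indicator {\<omega> \<in> space M. X k j \<omega> \<le> t} \<omega> :: real)"
      if "\<omega> \<in> space M" for \<omega>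
      using that by (simp add: indicator_def)
    have [measurable]: "{\<omega> \<in> space M. X k j \<omega> \<le> t} \<in> events" using that by measurable
    show "expectation (\<lambda>\<omega>. indicator {..t} (X k j \<omega>)) = F k j t"
      using F[OF that] by (simp add: eq cong: Bochner_Integration.integral_cong)
    show "integrable M (\<lambda>\<omega>. indicator {..t} (X k j \<omega>) :: real)"
      by (simp add: eq emeasure_eq_measure cong: Bochner_Integration.integrable_cong)
  qed
  have Y_mean: "expectation (Y k j) = F k j (x * \<tau> k) - F k j 0" if "j < B k" for k j
    unfolding Y_def using that by (simp add: ind_mean ind_int)
  have Y_abs: "expectation (\<lambda>\<omega>. \<bar>Y k j \<omega>\<bar>) = \<bar>F k j (x * \<tau> k) - F k j 0\<bar>" if "j < B k" for k j
  proof -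
    have "0 \<le> \<tau> k" by (simp add: \<tau>_def)
    \<comment> \<open>At every sample point the difference of indicators has the sign of
      \<open>x\<close> or vanishes, so the absolute value can be taken outside the
      expectation.\<close>
    have "\<exists>s\<in>{1, - 1}. \<forall>\<omega>. \<bar>Y k j \<omega>\<bar> = s * Y k j \<omega>"
    proof (cases "0 \<le> x")
      case True
      then have "0 \<le> x * \<tau> k" using \<open>0 \<le> \<tau> k\<close> by simp
      then have "\<bar>Y k j \<omega>\<bar> = 1 * Y k j \<omega>" for \<omega> by (auto simp: Y_def indicator_def)
      then show ?thesis by blast
    next
      case False
      then have "x * \<tau> k \<le> 0" using \<open>0 \<le> \<tau> k\<close> by (simp add: mult_nonpos_nonneg)
      then have "\<bar>Y k j \<omega>\<bar> = - 1 * Y k j \<omega>" for \<omega> by (auto simp: Y_def indicator_def)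
      then show ?thesis by blast
    qed
    then obtain s where "s \<in> {1, - 1}" and s: "\<And>\<omega>. \<bar>Y k j \<omega>\<bar> = s * Y k j \<omega>" by blast
    then have s_abs: "\<bar>s\<bar> = 1" by auto
    have "0 \<le> expectation (\<lambda>\<omega>. \<bar>Y k j \<omega>\<bar>)" by simp
    then have "expectation (\<lambda>\<omega>. \<bar>Y k j \<omega>\<bar>) = \<bar>s * expectation (Y k j)\<bar>" by (simp add: s)
    then show ?thesis using s_abs that by (simp add: abs_mult Y_mean)
  qed
  \<comment> \<open>Eventually the remainder of the expansion at \<open>x * \<tau>\<close> is
    \<open>e k / sqrt B\<close>; the second half of \<open>local_expansion_regime\<close> makes
    \<open>e\<close> tend to 0.\<close>
  define e where "e k = \<bar>x\<bar> powr (\<rho> + \<Delta>) * (C k / m k * w k powr (- \<Delta> / \<rho>))" for k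
  have e_lim: "e \<longlonglongrightarrow> 0" unfolding e_def by (intro tendsto_mult_right_zero rem_lim)
  have "(\<lambda>k. \<bar>x * \<tau> k\<bar>) \<longlonglongrightarrow> \<bar>x * 0\<bar>" by (intro tendsto_intros \<tau>_lim)
  then have "\<forall>\<^sub>F k in sequentially. \<bar>x * \<tau> k\<bar> < \<eta>"
    using \<open>0 < \<eta>\<close> by (intro order_tendstoD(2)) auto
  then have approx: "\<forall>\<^sub>F k in sequentially. \<forall>j<B k.
      \<bar>F k j (x * \<tau> k) - F k j 0 - signed_powr \<rho> x / sqrt (real (B k))\<bar> \<le> e k / sqrt (real (B k))"
    using expansion B_pos
  proof eventually_elim
    case (elim k)
    define b where "b = sqrt (real (B k))"
    have "0 < b" using elim(3) by (simp add: b_def)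
    then have "0 < w k" using params(4)[of k] by (simp add: w_def b_def)
    have w: "w k = m k * b" by (simp add: w_def b_def)
    have \<tau>: "\<tau> k = w k powr (- 1 / \<rho>)" by (simp add: \<tau>_def w_def)
    then have "0 < \<tau> k" using \<open>0 < w k\<close> by simp
    have "m k * \<bar>x * \<tau> k\<bar> powr \<rho> * sgn (x * \<tau> k) = m k * signed_powr \<rho> (\<tau> k * x)"
      by (simp add: signed_powr_def mult.commute)
    also have "\<dots> = m k * (\<tau> k powr \<rho> * signed_powr \<rho> x)"
      using \<open>0 < \<tau> k\<close> by (simp add: signed_powr_mult)
    also have "\<tau> k powr \<rho> = 1 / w k"
    proof -
      have "- 1 / \<rho> * \<rho> = - 1" using params(1) by simp
      then show ?thesis using \<open>0 < w k\<close> by (simp only: \<tau> powr_powr powr_minus_divide powr_one)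
    qed
    also have "m k * (1 / w k * signed_powr \<rho> x) = signed_powr \<rho> x / b"
      using params(4)[of k] by (simp add: w)
    finally have main: "m k * \<bar>x * \<tau> k\<bar> powr \<rho> * sgn (x * \<tau> k) = signed_powr \<rho> x / b" .
    have "C k * \<bar>x * \<tau> k\<bar> powr (\<rho> + \<Delta>) = C k * (\<bar>x\<bar> powr (\<rho> + \<Delta>) * \<tau> k powr (\<rho> + \<Delta>))"
      using \<open>0 < \<tau> k\<close> by (simp add: abs_mult powr_mult)
    also have "\<tau> k powr (\<rho> + \<Delta>) = w k powr (- \<Delta> / \<rho>) / w k"
    proof -
      have "- 1 / \<rho> * (\<rho> + \<Delta>) = - \<Delta> / \<rho> - 1" using params(1) by (simp add: field_simps)
      then show ?thesis using \<open>0 < w k\<close> by (simp only: \<tau> powr_powr powr_diff powr_one)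
    qed
    also have "C k * (\<bar>x\<bar> powr (\<rho> + \<Delta>) * (w k powr (- \<Delta> / \<rho>) / w k)) = e k / b"
      using params(4)[of k] by (simp add: e_def w)
    finally have rem: "C k * \<bar>x * \<tau> k\<bar> powr (\<rho> + \<Delta>) = e k / b" .
    have "\<bar>F k j (x * \<tau> k) - F k j 0 - signed_powr \<rho> x / b\<bar> \<le> e k / b" if "j < B k" for j
      using elim(1,2) that unfolding main[symmetric] rem[symmetric] by blast
    then show ?case unfolding b_def by blast
  qed
  have "null_in_probability M (\<lambda>k \<omega>. (\<Sum>j<B k. Y k j \<omega>) / sqrt (real (B k)) - signed_powr \<rho> x)"
  proof (rule null_in_probability_indep_sum)
    show "indep_vars (\<lambda>_. borel) (Y k) {..<B k}" for k
      unfolding Y_def by (rule indep_vars_compose2[OF indep]) measurable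
    show "\<bar>Y k j \<omega>\<bar> \<le> 1" for k j \<omega> by (simp add: Y_def indicator_def)
    show "\<forall>\<^sub>F k in sequentially. 0 < B k" by fact
    have "(\<lambda>k. (\<Sum>j<B k. expectation (Y k j)) / sqrt (real (B k)) - signed_powr \<rho> x) \<longlonglongrightarrow> 0"
    proof (rule Lim_null_comparison[OF _ e_lim])
      show "\<forall>\<^sub>F k in sequentially. norm ((\<Sum>j<B k. expectation (Y k j)) / sqrt (real (B k)) - signed_powr \<rho> x) \<le> e k"
        using approx B_pos
      proof eventually_elim
        case (elim k)
        define b where "b = sqrt (real (B k))"
        have "0 < b" "real (B k) = b * b" using elim(2) by (simp_all add: b_def)
        have "(\<Sum>j<B k. expectation (Y k j)) / b - signed_powr \<rho> x
            = (\<Sum>j<B k. F k j (x * \<tau> k) - F k j 0 - signed_powr \<rho> x / b) / b"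
          using \<open>0 < b\<close> by (simp add: Y_mean sum_subtractf \<open>real (B k) = b * b\<close> diff_divide_distrib)
        also have "norm \<dots> \<le> (\<Sum>j<B k. e k / b) / b"
        proof -
          have "\<bar>\<Sum>j<B k. F k j (x * \<tau> k) - F k j 0 - signed_powr \<rho> x / b\<bar> \<le> (\<Sum>j<B k. e k / b)"
            using elim(1) unfolding b_def[symmetric]
            by (intro order_trans[OF sum_abs] sum_mono) auto
          then show ?thesis using \<open>0 < b\<close> by (metis abs_divide abs_of_pos divide_right_mono less_imp_le real_norm_def)
        qed
        also have "\<dots> = e k" using \<open>0 < b\<close> by (simp add: \<open>real (B k) = b * b\<close>)
        finally show ?case by (simp add: b_def)
      qed
    qed
    then show "(\<lambda>k. (\<Sum>j<B k. expectation (Y k j)) / sqrt (real (B k))) \<longlonglongrightarrow> signed_powr \<rho> x"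
      by (simp add: LIM_zero_iff)
    show "(\<lambda>k. (\<Sum>j<B k. expectation (\<lambda>\<omega>. \<bar>Y k j \<omega>\<bar>)) / real (B k)) \<longlonglongrightarrow> 0"
    proof (rule Lim_null_comparison)
      show "(\<lambda>k. (\<bar>signed_powr \<rho> x\<bar> + e k) / sqrt (real (B k))) \<longlonglongrightarrow> 0"
        by (rule tendsto_divide_0[OF tendsto_add[OF tendsto_const e_lim]
              filterlim_at_top_imp_at_infinity[OF sqrt_lim]])
      show "\<forall>\<^sub>F k in sequentially. norm ((\<Sum>j<B k. expectation (\<lambda>\<omega>. \<bar>Y k j \<omega>\<bar>)) / real (B k))
          \<le> (\<bar>signed_powr \<rho> x\<bar> + e k) / sqrt (real (B k))"
        using approx B_pos
      proof eventually_elim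
        case (elim k)
        define b where "b = sqrt (real (B k))"
        have "0 < b" using elim(2) by (simp add: b_def)
        have each: "\<bar>F k j (x * \<tau> k) - F k j 0\<bar> \<le> (\<bar>signed_powr \<rho> x\<bar> + e k) / b" if "j < B k" for j
        proof -
          have "\<bar>signed_powr \<rho> x / b\<bar> = \<bar>signed_powr \<rho> x\<bar> / b" using \<open>0 < b\<close> by simp
          moreover have "\<bar>F k j (x * \<tau> k) - F k j 0 - signed_powr \<rho> x / b\<bar> \<le> e k / b"
            using elim(1) that unfolding b_def by blast
          ultimately show ?thesis unfolding add_divide_distrib by linarith
        qed
        have "(\<Sum>j<B k. expectation (\<lambda>\<omega>. \<bar>Y k j \<omega>\<bar>)) \<le> (\<Sum>j<B k. (\<bar>signed_powr \<rho> x\<bar> + e k) / b)"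
          by (intro sum_mono) (simp add: Y_abs each)
        then have "(\<Sum>j<B k. expectation (\<lambda>\<omega>. \<bar>Y k j \<omega>\<bar>)) / real (B k) \<le> (\<bar>signed_powr \<rho> x\<bar> + e k) / b"
          using elim(2) by (simp add: divide_le_eq mult.commute)
        moreover have "0 \<le> (\<Sum>j<B k. expectation (\<lambda>\<omega>. \<bar>Y k j \<omega>\<bar>)) / real (B k)"
          by (intro divide_nonneg_nonneg sum_nonneg) auto
        ultimately show ?case by (simp only: b_def real_norm_def abs_of_nonneg)
      qed
    qed
  qed
  then show ?thesis by (simp add: Y_def)
qed

end

subsection \<open>Independence of the batch estimates\<close>

text \<open>Measurability of \<open>A\<close> is assumed on vectors indexed by an initial segment of
  the naturals; numbering a batch by rank turns it into such a vector.\<close>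

lemma estimate_eq_restrict:
  "estimate A w I = A (map (\<lambda>i\<in>{..<card I}. w (sorted_list_of_set I ! i)) [0..<card I])"
proof -
  have "map w (sorted_list_of_set I) = map (\<lambda>i\<in>{..<card I}. w (sorted_list_of_set I ! i)) [0..<card I]"
    by (rule nth_equalityI) auto
  then show ?thesis by (simp add: estimate_def)
qed

lemma estimate_restrict: "finite I \<Longrightarrow> estimate A (restrict w I) I = estimate A w I"
  unfolding estimate_def by (intro arg_cong[where f = A] map_cong) auto

lemma borel_measurable_estimate:
  assumes A_meas: "\<And>m. (\<lambda>x. A (map x [0..<m])) \<in> borel_measurable (Pi\<^sub>M {..<m} (\<lambda>_. S))"
    and "finite I" "I \<subseteq> J"
  shows "(\<lambda>w. estimate A w I) \<in> borel_measurable (Pi\<^sub>M J (\<lambda>_. S))"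
proof -
  have "sorted_list_of_set I ! i \<in> J" if "i < card I" for i
    using nth_mem[of i "sorted_list_of_set I"] that assms(2,3) by auto
  then have "(\<lambda>w. \<lambda>i\<in>{..<card I}. w (sorted_list_of_set I ! i))
      \<in> measurable (Pi\<^sub>M J (\<lambda>_. S)) (Pi\<^sub>M {..<card I} (\<lambda>_. S))"
    by (intro measurable_restrict measurable_component_singleton) auto
  from measurable_compose[OF this A_meas] show ?thesis
    by (simp add: estimate_eq_restrict)
qed

lemma finite_splits: "finite (splits N B s)"
  by (rule finite_subset[of _ "{..<B} \<rightarrow>\<^sub>E Pow {..<N}"]) (auto simp: splits_def intro!: finite_PiE)

context prob_space
begin

lemma indep_rvD:
  assumes "indep_rv M S X T Y" "A \<in> sets S" "C \<in> sets T"
  shows "prob ((X -` A \<inter> space M) \<inter> (Y -` C \<inter> space M))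
    = prob (X -` A \<inter> space M) * prob (Y -` C \<inter> space M)"
  using assms unfolding indep_rv_def by (intro indep_setD) (auto intro: in_vimage_algebra)

lemma distr_iid_vector:
  assumes indep: "indep_vars (\<lambda>_. S) W UNIV" and ident: "\<And>i. distr M S (W i) = Q"
    and "distinct l"
  shows "distr M (Pi\<^sub>M {..<length l} (\<lambda>_. S)) (\<lambda>\<omega>. \<lambda>i\<in>{..<length l}. W (l ! i) \<omega>)
    = Pi\<^sub>M {..<length l} (\<lambda>_. Q)"
proof (cases "l = []")
  case True
  \<comment> \<open>The characterisation of independence by a product law excludes an empty index
    set; the empty product is the unit mass on one function.\<close>
  have "distr M (count_space {\<lambda>_. undefined}) (\<lambda>\<omega>. \<lambda>_. undefined) = count_space {\<lambda>_. undefined}"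
  proof (rule measure_eqI)
    fix X assume "X \<in> sets (distr M (count_space {\<lambda>_. undefined}) (\<lambda>\<omega>. \<lambda>_. undefined))"
    then have "X = {} \<or> X = {\<lambda>_. undefined}" by auto
    then show "emeasure (distr M (count_space {\<lambda>_. undefined}) (\<lambda>\<omega>. \<lambda>_. undefined)) X
        = emeasure (count_space {\<lambda>_. undefined}) X"
      by (auto simp: emeasure_distr emeasure_space_1)
  qed simp
  then show ?thesis by (simp add: True PiM_empty restrict_def)
next
  case False
  have meas [measurable]: "random_variable S (W i)" for i
    using indep by (simp add: indep_vars_def2)
  \<comment> \<open>Distinct entries give disjoint one-element blocks, through which independence
    passes to the re-indexed family.\<close>
  have "disjoint_family_on (\<lambda>i. {l ! i}) {..<length l}"
    using \<open>distinct l\<close> by (auto simp: disjoint_family_on_def nth_eq_iff_index_eq)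
  from indep_vars_restrict[OF indep _ this]
  have "indep_vars (\<lambda>i. Pi\<^sub>M {l ! i} (\<lambda>_. S)) (\<lambda>i \<omega>. restrict (\<lambda>i. W i \<omega>) {l ! i}) {..<length l}"
    by simp
  then have "indep_vars (\<lambda>_. S) (\<lambda>i \<omega>. restrict (\<lambda>i. W i \<omega>) {l ! i} (l ! i)) {..<length l}"
    by (rule indep_vars_compose2) simp
  then have "indep_vars (\<lambda>_. S) (\<lambda>i. W (l ! i)) {..<length l}" by simp
  then show ?thesis
    using False by (subst (asm) indep_vars_iff_distr_eq_PiM') (auto simp: ident lessThan_empty_iff)
qed

text \<open>Any \<open>m\<close> distinct observations have the same product law, whichever indices
  they carry. This supplies marginal laws that do not depend on the realised split.\<close>

lemma distr_estimate:
  assumes indep: "indep_vars (\<lambda>_. S) W UNIV" and ident: "\<And>i. distr M S (W i) = Q"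
    and A_meas: "\<And>m. (\<lambda>x. A (map x [0..<m])) \<in> borel_measurable (Pi\<^sub>M {..<m} (\<lambda>_. S))"
    and "finite I" "card I = m"
  shows "distr M borel (\<lambda>\<omega>. estimate A (\<lambda>i. W i \<omega>) I)
    = distr (Pi\<^sub>M {..<m} (\<lambda>_. Q)) borel (\<lambda>x. A (map x [0..<m]))"
proof -
  let ?l = "sorted_list_of_set I"
  have meas: "random_variable S (W i)" for i
    using indep by (simp add: indep_vars_def2)
  have len: "length ?l = m" using assms(4,5) by simp
  have vec: "(\<lambda>\<omega>. \<lambda>i\<in>{..<m}. W (?l ! i) \<omega>) \<in> measurable M (Pi\<^sub>M {..<m} (\<lambda>_. S))"
    by (intro measurable_restrict meas)
  have "distr M borel (\<lambda>\<omega>. estimate A (\<lambda>i. W i \<omega>) I)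
      = distr (distr M (Pi\<^sub>M {..<m} (\<lambda>_. S)) (\<lambda>\<omega>. \<lambda>i\<in>{..<m}. W (?l ! i) \<omega>)) borel (\<lambda>x. A (map x [0..<m]))"
    unfolding estimate_eq_restrict using assms(5)
    by (subst distr_distr[OF A_meas vec]) (simp add: comp_def)
  also have "distr M (Pi\<^sub>M {..<m} (\<lambda>_. S)) (\<lambda>\<omega>. \<lambda>i\<in>{..<m}. W (?l ! i) \<omega>) = Pi\<^sub>M {..<m} (\<lambda>_. Q)"
    by (rule distr_iid_vector[OF indep ident, of ?l, unfolded len]) simp
  finally show ?thesis .
qed

lemma indep_vars_estimate:
  assumes indep: "indep_vars (\<lambda>_. S) W UNIV"
    and A_meas: "\<And>m. (\<lambda>x. A (map x [0..<m])) \<in> borel_measurable (Pi\<^sub>M {..<m} (\<lambda>_. S))"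
    and "disjoint_family_on d J" and fin: "\<And>j. j \<in> J \<Longrightarrow> finite (d j)"
  shows "indep_vars (\<lambda>_. borel) (\<lambda>j \<omega>. estimate A (\<lambda>i. W i \<omega>) (d j)) J"
proof -
  have "indep_vars (\<lambda>j. Pi\<^sub>M (d j) (\<lambda>_. S)) (\<lambda>j \<omega>. restrict (\<lambda>i. W i \<omega>) (d j)) J"
    by (rule indep_vars_restrict[OF indep _ assms(3)]) simp
  then have "indep_vars (\<lambda>_. borel) (\<lambda>j \<omega>. estimate A (restrict (\<lambda>i. W i \<omega>) (d j)) (d j)) J"
    by (rule indep_vars_compose2) (intro borel_measurable_estimate A_meas fin subset_refl)
  then show ?thesis
    by (rule indep_vars_cong[THEN iffD1, rotated -1]) (auto simp: estimate_restrict fin)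
qed

text \<open>Independence survives mixing over \<open>D\<close> because the marginal laws \<open>\<nu> j\<close> do not depend on \<open>d\<close>.\<close>

lemma indep_vars_mixture:
  fixes D :: "'a \<Rightarrow> 'd" and Z :: "'d \<Rightarrow> 'j \<Rightarrow> 'a \<Rightarrow> 'b"
  assumes "finite \<D>" and D: "D \<in> measurable M (count_space \<D>)" and "finite J"
    and indep: "\<And>d. d \<in> \<D> \<Longrightarrow> indep_vars (\<lambda>_. N) (Z d) J"
    and law: "\<And>d j. d \<in> \<D> \<Longrightarrow> j \<in> J \<Longrightarrow> distr M N (Z d j) = \<nu> j"
    and cond: "\<And>d K C. d \<in> \<D> \<Longrightarrow> K \<subseteq> J \<Longrightarrow> (\<And>j. j \<in> K \<Longrightarrow> C j \<in> sets N) \<Longrightarrow>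
      prob ({\<omega> \<in> space M. \<forall>j\<in>K. Z d j \<omega> \<in> C j} \<inter> {\<omega> \<in> space M. D \<omega> = d})
        = prob {\<omega> \<in> space M. \<forall>j\<in>K. Z d j \<omega> \<in> C j} * prob {\<omega> \<in> space M. D \<omega> = d}"
  shows "indep_vars (\<lambda>_. N) (\<lambda>j \<omega>. Z (D \<omega>) j \<omega>) J"
proof -
  have Z_meas: "random_variable N (Z d j)" if "d \<in> \<D>" "j \<in> J" for d j
    using indep[OF that(1)] that(2) by (simp add: indep_vars_def2)
  have ZD_meas: "random_variable N (\<lambda>\<omega>. Z (D \<omega>) j \<omega>)" if "j \<in> J" for j
    by (rule measurable_compose_countable'[OF _ D]) (use that Z_meas \<open>finite \<D>\<close> in \<open>auto intro: countable_finite\<close>)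
  have D_sets: "{\<omega> \<in> space M. D \<omega> = d} \<in> events" if "d \<in> \<D>" for d
  proof -
    have "{\<omega> \<in> space M. D \<omega> = d} = D -` {d} \<inter> space M" by auto
    then show ?thesis using measurable_sets[OF D, of "{d}"] that by simp
  qed
  have D_in: "D \<omega> \<in> \<D>" if "\<omega> \<in> space M" for \<omega>
    using measurable_space[OF D that] by simp
  have D_sum: "(\<Sum>d\<in>\<D>. prob {\<omega> \<in> space M. D \<omega> = d}) = 1"
  proof -
    have "(\<Sum>d\<in>\<D>. prob {\<omega> \<in> space M. D \<omega> = d}) = prob (\<Union>d\<in>\<D>. {\<omega> \<in> space M. D \<omega> = d})"
      by (rule finite_measure_finite_Union[symmetric])
        (use \<open>finite \<D>\<close> D_sets in \<open>auto simp: disjoint_family_on_def\<close>)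
    also have "(\<Union>d\<in>\<D>. {\<omega> \<in> space M. D \<omega> = d}) = space M" using D_in by auto
    finally show ?thesis by (simp add: prob_space)
  qed
  have key: "prob {\<omega> \<in> space M. \<forall>j\<in>K. Z (D \<omega>) j \<omega> \<in> C j} = (\<Prod>j\<in>K. measure (\<nu> j) (C j))"
    if K: "K \<subseteq> J" "K \<noteq> {}" and C: "\<And>j. j \<in> K \<Longrightarrow> C j \<in> sets N" for K C
  proof -
    have "finite K" using K(1) \<open>finite J\<close> by (rule finite_subset)
    have sets: "{\<omega> \<in> space M. \<forall>j\<in>K. Z d j \<omega> \<in> C j} \<in> events" if "d \<in> \<D>" for d
    proof (intro sets.sets_Collect_finite_All \<open>finite K\<close>)
      fix j assume "j \<in> K"
      then have "Z d j -` C j \<inter> space M \<in> events"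
        using K(1) C Z_meas[OF \<open>d \<in> \<D>\<close>, of j] by (auto intro: measurable_sets)
      moreover have "{\<omega> \<in> space M. Z d j \<omega> \<in> C j} = Z d j -` C j \<inter> space M" by auto
      ultimately show "{\<omega> \<in> space M. Z d j \<omega> \<in> C j} \<in> events" by simp
    qed
    have each: "prob {\<omega> \<in> space M. \<forall>j\<in>K. Z d j \<omega> \<in> C j} = (\<Prod>j\<in>K. measure (\<nu> j) (C j))"
      if "d \<in> \<D>" for d
    proof -
      have "prob (\<Inter>j\<in>K. Z d j -` C j \<inter> space M) = (\<Prod>j\<in>K. prob (Z d j -` C j \<inter> space M))"
        by (rule indep_varsD_finite[OF indep_vars_subset[OF indep[OF that] K(1)]])
          (use K \<open>finite K\<close> C in auto)
      also have "(\<Inter>j\<in>K. Z d j -` C j \<inter> space M) = {\<omega> \<in> space M. \<forall>j\<in>K. Z d j \<omega> \<in> C j}"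
        using K(2) by auto
      also have "(\<Prod>j\<in>K. prob (Z d j -` C j \<inter> space M)) = (\<Prod>j\<in>K. measure (\<nu> j) (C j))"
      proof (rule prod.cong)
        fix j assume "j \<in> K"
        then have "j \<in> J" using K(1) by auto
        show "prob (Z d j -` C j \<inter> space M) = measure (\<nu> j) (C j)"
          unfolding law[OF that \<open>j \<in> J\<close>, symmetric]
          using C[OF \<open>j \<in> K\<close>] Z_meas[OF that \<open>j \<in> J\<close>] by (simp add: measure_distr)
      qed simp
      finally show ?thesis .
    qed
    \<comment> \<open>On \<open>D = d\<close> the mixture is \<open>Z d\<close>. Then
      \<open>cond\<close> splits off the probability of that event, the product of marginals is the
      same for all \<open>d\<close>, and the weights add up to 1.\<close>
    have "{\<omega> \<in> space M. \<forall>j\<in>K. Z (D \<omega>) j \<omega> \<in> C j}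
        = (\<Union>d\<in>\<D>. {\<omega> \<in> space M. \<forall>j\<in>K. Z d j \<omega> \<in> C j} \<inter> {\<omega> \<in> space M. D \<omega> = d})"
      using D_in by auto
    also have "prob \<dots> = (\<Sum>d\<in>\<D>. prob ({\<omega> \<in> space M. \<forall>j\<in>K. Z d j \<omega> \<in> C j} \<inter> {\<omega> \<in> space M. D \<omega> = d}))"
      by (rule finite_measure_finite_Union)
        (use \<open>finite \<D>\<close> D_sets sets in \<open>auto simp: disjoint_family_on_def\<close>)
    also have "\<dots> = (\<Sum>d\<in>\<D>. (\<Prod>j\<in>K. measure (\<nu> j) (C j)) * prob {\<omega> \<in> space M. D \<omega> = d})"
      by (intro sum.cong refl) (simp add: cond K C each)
    also have "\<dots> = (\<Prod>j\<in>K. measure (\<nu> j) (C j))"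
      by (simp add: D_sum flip: sum_distrib_left)
    finally show ?thesis .
  qed
  show ?thesis
    unfolding indep_vars_def2
  proof (intro conjI ballI indep_setsI)
    fix K A
    assume K: "K \<noteq> {}" "K \<subseteq> J" "finite K"
      and A: "\<forall>j\<in>K. A j \<in> {(\<lambda>\<omega>. Z (D \<omega>) j \<omega>) -` C \<inter> space M | C. C \<in> sets N}"
    from A have "\<forall>j\<in>K. \<exists>C. C \<in> sets N \<and> A j = (\<lambda>\<omega>. Z (D \<omega>) j \<omega>) -` C \<inter> space M" by blast
    from bchoice[OF this] obtain C
      where C: "\<And>j. j \<in> K \<Longrightarrow> C j \<in> sets N" "\<And>j. j \<in> K \<Longrightarrow> A j = (\<lambda>\<omega>. Z (D \<omega>) j \<omega>) -` C j \<inter> space M"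
      by blast
    have "(\<Inter>j\<in>K. A j) = {\<omega> \<in> space M. \<forall>j\<in>K. Z (D \<omega>) j \<omega> \<in> C j}"
      using K(1) C(2) by auto
    then have "prob (\<Inter>j\<in>K. A j) = (\<Prod>j\<in>K. measure (\<nu> j) (C j))"
      using key[OF K(2,1) C(1)] by simp
    moreover have "prob (A j) = measure (\<nu> j) (C j)" if "j \<in> K" for j
    proof -
      \<comment> \<open>One-element sets \<open>K\<close> identify the marginal laws of the
        mixture.\<close>
      have "A j = {\<omega> \<in> space M. \<forall>i\<in>{j}. Z (D \<omega>) i \<omega> \<in> C i}" using C(2)[OF that] by auto
      then show ?thesis using key[of "{j}" C] that K(2) C(1) by auto
    qed
    ultimately show "prob (\<Inter>j\<in>K. A j) = (\<Prod>j\<in>K. prob (A j))" by simp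
  next
    fix j assume "j \<in> J"
    then show "{(\<lambda>\<omega>. Z (D \<omega>) j \<omega>) -` C \<inter> space M | C. C \<in> sets N} \<subseteq> events"
      using measurable_sets[OF ZD_meas] by auto
  qed (rule ZD_meas)
qed

text \<open>\<open>splits\<close> prescribes the batch sizes, so the law of the \<open>j\<close>-th
  estimate is the same for every split; within one split the batches are disjoint blocks of
  independent observations. These two facts feed the mixture argument.\<close>

lemma indep_vars_random_split:
  assumes indep: "indep_vars (\<lambda>_. S) W UNIV" and ident: "\<And>i. distr M S (W i) = distr M S (W 0)"
    and A_meas: "\<And>m. (\<lambda>x. A (map x [0..<m])) \<in> borel_measurable (Pi\<^sub>M {..<m} (\<lambda>_. S))"
    and D: "D \<in> measurable M (count_space (splits N B s))"
    and U: "U \<in> borel_measurable M"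
    and W_DU: "indep_rv M (Pi\<^sub>M UNIV (\<lambda>_. S)) (\<lambda>\<omega> i. W i \<omega>)
      (count_space (splits N B s) \<Otimes>\<^sub>M borel) (\<lambda>\<omega>. (D \<omega>, U \<omega> :: real))"
  shows "indep_vars (\<lambda>_. borel) (\<lambda>j \<omega>. estimate A (\<lambda>i. W i \<omega>) (D \<omega> j)) {..<B}"
proof (rule indep_vars_mixture[where Z = "\<lambda>d j \<omega>. estimate A (\<lambda>i. W i \<omega>) (d j)", OF finite_splits D])
  fix d assume d: "d \<in> splits N B s"
  have fin: "finite (d j)" if "j < B" for j
  proof (rule finite_subset[OF _ finite_lessThan])
    show "d j \<subseteq> {..<N}" using d that by (auto simp: splits_def PiE_iff)
  qed
  show "indep_vars (\<lambda>_. borel) (\<lambda>j \<omega>. estimate A (\<lambda>i. W i \<omega>) (d j)) {..<B}"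
    using d fin by (intro indep_vars_estimate[OF indep A_meas]) (auto simp: splits_def)
  show "distr M borel (\<lambda>\<omega>. estimate A (\<lambda>i. W i \<omega>) (d j))
      = distr (Pi\<^sub>M {..<s j} (\<lambda>_. distr M S (W 0))) borel (\<lambda>x. A (map x [0..<s j]))" if "j \<in> {..<B}" for j
    using d that fin by (intro distr_estimate[OF indep ident A_meas]) (auto simp: splits_def)
  fix K :: "nat set" and C :: "nat \<Rightarrow> real set"
  assume K: "K \<subseteq> {..<B}" and C: "\<And>j. j \<in> K \<Longrightarrow> C j \<in> sets borel"
  let ?S = "Pi\<^sub>M UNIV (\<lambda>_. S)"
  have "finite K" using K by (rule finite_subset) simp
  have est: "(\<lambda>w. estimate A w (d j)) \<in> borel_measurable ?S" if "j \<in> K" for j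
    using K that by (intro borel_measurable_estimate A_meas fin) auto
  have E: "{w \<in> space ?S. \<forall>j\<in>K. estimate A w (d j) \<in> C j} \<in> sets ?S"
  proof (intro sets.sets_Collect_finite_All \<open>finite K\<close>)
    fix j assume "j \<in> K"
    then have "(\<lambda>w. estimate A w (d j)) -` C j \<inter> space ?S \<in> sets ?S"
      using est C by (intro measurable_sets)
    moreover have "{w \<in> space ?S. estimate A w (d j) \<in> C j} = (\<lambda>w. estimate A w (d j)) -` C j \<inter> space ?S" by auto
    ultimately show "{w \<in> space ?S. estimate A w (d j) \<in> C j} \<in> sets ?S" by simp
  qed
  \<comment> \<open>This rectangle reduces independence of the data from the pair
    \<open>(D, U)\<close> to independence from \<open>D\<close>.\<close>
  have F: "{d} \<times> UNIV \<in> sets (count_space (splits N B s) \<Otimes>\<^sub>M (borel :: real measure))"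
    using d by (intro pair_measureI) auto
  have W_meas: "random_variable S (W i)" for i
    using indep by (simp add: indep_vars_def2)
  have path: "(\<lambda>i. W i \<omega>) \<in> space ?S" if "\<omega> \<in> space M" for \<omega>
    by (simp add: space_PiM PiE_iff measurable_space[OF W_meas that])
  have "(\<lambda>\<omega> i. W i \<omega>) -` {w \<in> space ?S. \<forall>j\<in>K. estimate A w (d j) \<in> C j} \<inter> space M
      = {\<omega> \<in> space M. \<forall>j\<in>K. estimate A (\<lambda>i. W i \<omega>) (d j) \<in> C j}"
    using path by auto
  moreover have "(\<lambda>\<omega>. (D \<omega>, U \<omega>)) -` ({d} \<times> UNIV) \<inter> space M = {\<omega> \<in> space M. D \<omega> = d}"
    by auto
  ultimately show "prob ({\<omega> \<in> space M. \<forall>j\<in>K. estimate A (\<lambda>i. W i \<omega>) (d j) \<in> C j} \<inter> {\<omega> \<in> space M. D \<omega> = d})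
      = prob {\<omega> \<in> space M. \<forall>j\<in>K. estimate A (\<lambda>i. W i \<omega>) (d j) \<in> C j} * prob {\<omega> \<in> space M. D \<omega> = d}"
    using indep_rvD[OF W_DU E F] by simp
qed simp

end

subsection \<open>The width of the GHulC interval\<close>

lemma distr_std_normal_affine:
  assumes "a \<noteq> 0"
  shows "distr std_normal_distribution borel (\<lambda>x. b + a * x) = density lborel (normal_density b \<bar>a\<bar>)"
proof -
  interpret real_distribution std_normal_distribution by (rule real_dist_normal_dist)
  have "distributed std_normal_distribution lborel (\<lambda>x. x) std_normal_density"
    unfolding distributed_def by (auto intro!: distr_id2)
  then have "distributed std_normal_distribution lborel (\<lambda>x. b + a * x) (normal_density (b + a * 0) (\<bar>a\<bar> * 1))"
    using assms by (intro normal_density_affine) auto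
  then have "distr std_normal_distribution lborel (\<lambda>x. b + a * x) = density lborel (normal_density b \<bar>a\<bar>)"
    by (simp add: distributed_def)
  moreover have "distr std_normal_distribution lborel (\<lambda>x. b + a * x)
      = distr std_normal_distribution borel (\<lambda>x. b + a * x)"
    by (rule distr_cong) auto
  ultimately show ?thesis by simp
qed

text \<open>The law is invariant under negation and has no atom at 0, so both half-lines carry the
  same mass.\<close>

lemma cdf_std_normal_0: "cdf std_normal_distribution 0 = 1 / 2"
proof -
  interpret real_distribution std_normal_distribution by (rule real_dist_normal_dist)
  have "measure std_normal_distribution {..0} = measure (distr std_normal_distribution borel uminus) {..0}"
    using distr_std_normal_affine[of "- 1" 0] by simp
  also have "\<dots> = measure std_normal_distribution {0..}"
    by (subst measure_distr) (auto intro!: arg_cong[where f = "measure std_normal_distribution"])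
  finally have sym: "measure std_normal_distribution {..0} = measure std_normal_distribution {0..}" .
  have "measure std_normal_distribution {0..} = measure std_normal_distribution ({0} \<union> {0<..})"
    by (rule arg_cong[where f = "measure std_normal_distribution"]) auto
  also have "\<dots> = measure std_normal_distribution {0} + measure std_normal_distribution {0<..}"
    by (rule finite_measure_Union) auto
  also have "measure std_normal_distribution {0} = 0"
    using isCont_cdf isCont_cdf_std_normal by blast
  finally have "measure std_normal_distribution {0..} = measure std_normal_distribution {0<..}" by simp
  moreover have "measure std_normal_distribution ({..0} \<union> {0<..})
      = measure std_normal_distribution {..0} + measure std_normal_distribution {0<..}"
    by (rule finite_measure_Union) auto
  moreover have "({..0} \<union> {0<..} :: real set) = space std_normal_distribution" by auto
  ultimately show ?thesis using sym prob_space by (simp add: cdf_def)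
qed

text \<open>The cdf is one half at 0 and, by continuity, still below \<open>p\<close> slightly to
  the right. Positivity later separates the lower index of the interval from the upper one.\<close>

lemma normal_quantile_pos:
  assumes "1 / 2 < p" "p < 1"
  shows "0 < normal_quantile p"
proof -
  have "\<forall>\<^sub>F x in at_right 0. cdf std_normal_distribution x < p"
    using isCont_cdf_std_normal[of 0] assms(1)
    by (intro order_tendstoD(2)[of _ "cdf std_normal_distribution 0"])
      (auto simp: isCont_def cdf_std_normal_0 intro: filterlim_mono at_le)
  then obtain x where x: "0 < x" "cdf std_normal_distribution x < p"
    unfolding eventually_at_right_field by (metis dense)
  then have "\<not> normal_quantile p < x"
    using normal_quantile_less_imp[OF assms(2)] by force
  with x(1) show ?thesis by simp
qed

lemma width_Icc: "width {a..b} = (if a \<le> b then b - a else 0)"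
  by (simp add: width_def)

lemma scaled_order_stat_le_iff:
  fixes \<theta> :: "nat \<Rightarrow> real"
  assumes "0 < c" "0 < \<tau>" "1 \<le> i" "i \<le> int n"
  shows "c / \<tau> * (order_stat (map \<theta> [0..<n]) i - \<theta>\<^sub>0) \<le> x \<longleftrightarrow>
    real_of_int i \<le> (\<Sum>j<n. indicator {..x * \<tau>} (c * (\<theta> j - \<theta>\<^sub>0)))"
proof -
  \<comment> \<open>The bound \<open>x\<close> taken back to the scale of the estimates.\<close>
  define y where "y = \<theta>\<^sub>0 + x * \<tau> / c"
  have iff: "c / \<tau> * (u - \<theta>\<^sub>0) \<le> x \<longleftrightarrow> u \<le> y" "c * (u - \<theta>\<^sub>0) \<le> x * \<tau> \<longleftrightarrow> u \<le> y" for u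
    using assms(1,2) by (auto simp: y_def field_simps)
  have "real (length (filter (\<lambda>u. u \<le> y) (map \<theta> [0..<m])))
      = (\<Sum>j<m. indicator {..x * \<tau>} (c * (\<theta> j - \<theta>\<^sub>0)))" for m
    by (induction m) (auto simp: iff indicator_def)
  from this[of n] have count: "(\<Sum>j<n. indicator {..x * \<tau>} (c * (\<theta> j - \<theta>\<^sub>0)))
      = real (length (filter (\<lambda>u. u \<le> y) (map \<theta> [0..<n])))" by simp
  have "order_stat (map \<theta> [0..<n]) i \<le> y
      \<longleftrightarrow> i \<le> int (length (filter (\<lambda>u. u \<le> y) (map \<theta> [0..<n])))"
    using assms(3,4) by (intro order_stat_le_iff) auto
  then show ?thesis unfolding iff count by (metis of_int_le_iff of_int_of_nat_eq)
qed

lemma (in prob_space) null_in_probability_cong: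
  assumes "\<forall>\<^sub>F k in sequentially. \<forall>\<omega>\<in>space M. X k \<omega> = Y k \<omega>" "null_in_probability M X"
  shows "null_in_probability M Y"
  unfolding null_in_probability_def
proof (intro allI impI)
  fix \<epsilon> :: real assume "0 < \<epsilon>"
  have "\<forall>\<^sub>F k in sequentially. prob {\<omega> \<in> space M. \<epsilon> < \<bar>X k \<omega>\<bar>} = prob {\<omega> \<in> space M. \<epsilon> < \<bar>Y k \<omega>\<bar>}"
    using assms(1) by eventually_elim (auto intro!: arg_cong[where f = prob])
  then show "(\<lambda>k. prob {\<omega> \<in> space M. \<epsilon> < \<bar>Y k \<omega>\<bar>}) \<longlonglongrightarrow> 0"
    using assms(2) \<open>0 < \<epsilon>\<close> by (subst tendsto_cong[symmetric]) (auto simp: null_in_probability_def)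
qed

text \<open>Randomisation by \<open>U\<close> moves the index by at most 1, which is negligible
  against \<open>sqrt B\<close>.\<close>

lemma ghulc_cstar_bounds: "ghulc_c n \<alpha> - 1 \<le> ghulc_cstar n \<alpha> u" "ghulc_cstar n \<alpha> u \<le> ghulc_c n \<alpha>"
  by (auto simp: ghulc_cstar_def)

theorem theorem7:
  fixes P :: "'w measure" and S :: "'a measure"
    and W :: "nat \<Rightarrow> 'w \<Rightarrow> 'a" and A :: "'a list \<Rightarrow> real"
    and \<alpha> \<theta>\<^sub>0 \<rho> \<Delta> \<eta> :: real
    and r :: "nat \<Rightarrow> real"
    and N B :: "nat \<Rightarrow> nat" and s :: "nat \<Rightarrow> nat \<Rightarrow> nat"
    and D :: "nat \<Rightarrow> 'w \<Rightarrow> nat \<Rightarrow> nat set" and U :: "nat \<Rightarrow> 'w \<Rightarrow> real"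
    and M C E :: "nat \<Rightarrow> real"
    and F :: "nat \<Rightarrow> nat \<Rightarrow> real \<Rightarrow> real"
  assumes prob: "prob_space P"
    and alpha: "0 < \<alpha>" "\<alpha> < 1"
    \<comment> \<open>i.i.d. observations and the estimation procedure\<close>
    and indep: "prob_space.indep_vars P (\<lambda>_. S) W UNIV"
    and ident: "\<And>i. distr P S (W i) = distr P S (W 0)"
    and A_meas: "\<And>m. (\<lambda>x. A (map x [0..<m])) \<in> borel_measurable (Pi\<^sub>M {..<m} (\<lambda>_. S))"
    \<comment> \<open>rate of convergence\<close>
    and r_pos: "\<And>m. 0 < r m"
    and rate: "bounded_in_probability P (\<lambda>m \<omega>. r m * (estimate A (\<lambda>i. W i \<omega>) {..<m} - \<theta>\<^sub>0))"
    \<comment> \<open>number of batches, batch sizes, random split and auxiliary uniform variable\<close>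
    and B_ge: "\<And>k. log 2 (2 / \<alpha>) \<le> real (B k)"
    and sizes: "\<And>k j. j < B k \<Longrightarrow>
          \<lfloor>real (N k) / real (B k)\<rfloor> \<le> int (s k j) \<and> int (s k j) \<le> \<lceil>real (N k) / real (B k)\<rceil>"
    and D_meas: "\<And>k. D k \<in> measurable P (count_space (splits (N k) (B k) (s k)))"
    and U_meas: "\<And>k. U k \<in> borel_measurable P"
    and U_unif: "\<And>k. distr P lborel (U k) = uniform_measure lborel {0<..<1}"
    and DU_indep: "\<And>k. indep_rv P
          (count_space (splits (N k) (B k) (s k))) (D k) borel (U k)"
    and W_DU_indep: "\<And>k. indep_rv P
          (Pi\<^sub>M UNIV (\<lambda>_. S)) (\<lambda>\<omega> i. W i \<omega>)
          (count_space (splits (N k) (B k) (s k)) \<Otimes>\<^sub>M borel) (\<lambda>\<omega>. (D k \<omega>, U k \<omega>))"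
    \<comment> \<open>distribution function of the scaled estimation error on the \<open>j\<close>-th batch\<close>
    and F_def: "\<And>k j. j < B k \<Longrightarrow> F k j = cdf (distr P borel
          (\<lambda>\<omega>. r (N k div B k) * (estimate A (\<lambda>i. W i \<omega>) (D k \<omega> j) - \<theta>\<^sub>0)))"
    and params: "0 < \<rho>" "0 < \<Delta>" "0 < \<eta>" "\<And>k. 0 < M k" "\<And>k. 0 < C k"
    and expansion: "\<forall>\<^sub>F k in sequentially. \<forall>j<B k. \<forall>t. \<bar>t\<bar> < \<eta> \<longrightarrow>
          \<bar>F k j t - F k j 0 - M k * \<bar>t\<bar> powr \<rho> * sgn t\<bar> \<le> C k * \<bar>t\<bar> powr (\<rho> + \<Delta>)"
    and regime: "local_expansion_regime \<rho> \<Delta> M C B"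
    and median_bias: "\<forall>\<^sub>F k in sequentially. \<forall>j<B k. \<bar>F k j 0 - 1 / 2\<bar> \<le> E (B k)"
    and bias_rate: "(\<lambda>k. real (B k) * E (B k)) \<longlonglongrightarrow> 0"
    and NB_lim: "filterlim (\<lambda>k. real (N k) / real (B k)) at_top sequentially"
    and B_lim: "filterlim B at_top sequentially"
  shows "weak_conv_m
    (\<lambda>k. distr P borel (\<lambda>\<omega>.
       real (B k) powr (1 / (2 * \<rho>)) * r (N k div B k) * M k powr (1 / \<rho>) *
       width (ghulc_CI A (B k) \<alpha> (\<lambda>i. W i \<omega>) (D k \<omega>) (U k \<omega>))))
    (distr (density lborel (normal_density (normal_quantile (1 - \<alpha> / 2) / 2) (1 / 2))) borel
       (\<lambda>w. limit_fun \<rho> w (normal_quantile (1 - \<alpha> / 2))))"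
proof -
  interpret prob_space P by (rule prob)
  define z where "z = normal_quantile (1 - \<alpha> / 2)"
  have "0 < z" unfolding z_def using alpha by (intro normal_quantile_pos) auto
  define \<theta> where "\<theta> k \<omega> j = estimate A (\<lambda>i. W i \<omega>) (D k \<omega> j)" for k \<omega> j
  define X where "X k j \<omega> = r (N k div B k) * (\<theta> k \<omega> j - \<theta>\<^sub>0)" for k j \<omega>
  define \<tau> where "\<tau> k = (M k * sqrt (real (B k))) powr (- 1 / \<rho>)" for k
  define l where "l k = r (N k div B k) / \<tau> k" for k
  define R where "R k x \<omega> =
    (\<Sum>j<B k. indicator {..x * \<tau> k} (X k j \<omega>) - indicator {..0} (X k j \<omega>)) / sqrt (real (B k)) - signed_powr \<rho> x"
    for k x \<omega>
  \<comment> \<open>The sign makes the endpoints increase with \<open>G\<close>: few errors at or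
    below 0 move the order statistics up.\<close>
  define G where "G k \<omega> = (real (B k) - 2 * (\<Sum>j<B k. indicator {..0} (X k j \<omega>))) / sqrt (real (B k))" for k \<omega>
  have indep_\<theta>: "indep_vars (\<lambda>_. borel) (\<lambda>j \<omega>. \<theta> k \<omega> j) {..<B k}" for k
    unfolding \<theta>_def by (rule indep_vars_random_split[OF indep ident A_meas D_meas U_meas W_DU_indep])
  have indep_X: "indep_vars (\<lambda>_. borel) (X k) {..<B k}" for k
    unfolding X_def by (rule indep_vars_compose2[OF indep_\<theta>]) measurable
  have \<theta>_meas [measurable]: "j < B k \<Longrightarrow> (\<lambda>\<omega>. \<theta> k \<omega> j) \<in> borel_measurable P" for k j
    using indep_\<theta>[of k] by (simp add: indep_vars_def2)
  have X_meas [measurable]: "j < B k \<Longrightarrow> X k j \<in> borel_measurable P" for k j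
    using indep_X[of k] by (simp add: indep_vars_def2)
  have R_meas [measurable]: "R k x \<in> borel_measurable P" for k x
    unfolding R_def by measurable
  have G_meas [measurable]: "G k \<in> borel_measurable P" for k
    unfolding G_def by measurable
  have F: "F k j t = prob {\<omega> \<in> space P. X k j \<omega> \<le> t}" if "j < B k" for k j t
  proof -
    have "F k j t = measure (distr P borel (X k j)) {..t}"
      using F_def[OF that] by (simp add: cdf_def X_def[abs_def] \<theta>_def)
    also have "\<dots> = prob (X k j -` {..t} \<inter> space P)" using that by (subst measure_distr) auto
    also have "X k j -` {..t} \<inter> space P = {\<omega> \<in> space P. X k j \<omega> \<le> t}" by auto
    finally show ?thesis .
  qed
  have B_pos: "\<forall>\<^sub>F k in sequentially. 0 < B k"
    by (rule eventually_compose_filterlim[OF eventually_gt_at_top B_lim])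
  have R_null: "null_in_probability P (\<lambda>k. R k x)" for x
    unfolding R_def
    by (rule null_in_probability_local_count[OF indep_X F params(1-4) expansion regime B_lim \<tau>_def])
  have G_conv: "weak_conv_m (\<lambda>k. distr P borel (G k)) std_normal_distribution"
    unfolding G_def
  proof (rule weak_conv_bernoulli_sum[OF _ _ _ bias_rate B_lim])
    show "indep_vars (\<lambda>_. borel) (\<lambda>j \<omega>. indicator {..0} (X k j \<omega>)) {..<B k}" for k
      by (rule indep_vars_compose2[OF indep_X]) measurable
    show "(indicator {..0} (X k j \<omega>) :: real) = 0 \<or> (indicator {..0} (X k j \<omega>) :: real) = 1" for k j \<omega>
      by (simp add: indicator_def)
    have "expectation (\<lambda>\<omega>. indicator {..0} (X k j \<omega>)) = F k j 0" if "j < B k" for k j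
    proof -
      have [measurable]: "{\<omega> \<in> space P. X k j \<omega> \<le> 0} \<in> events" using that by measurable
      have "expectation (\<lambda>\<omega>. indicator {..0} (X k j \<omega>))
          = expectation (indicat_real {\<omega> \<in> space P. X k j \<omega> \<le> 0})"
        by (rule Bochner_Integration.integral_cong) (auto simp: indicator_def)
      then show ?thesis by (simp add: F[OF that])
    qed
    with median_bias show "\<forall>\<^sub>F k in sequentially. \<forall>j<B k.
        \<bar>expectation (\<lambda>\<omega>. indicator {..0} (X k j \<omega>)) - 1 / 2\<bar> \<le> E (B k)"
      by simp
  qed
  have G_bounded: "bounded_in_probability P G"
    by (rule bounded_in_probability_if_weak_conv[OF G_meas G_conv real_dist_normal_dist isCont_cdf_std_normal])
  have signed_powr_cont: "isCont (\<lambda>y. signed_powr (1 / \<rho>) (b + y / 2)) y" for b y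
    by (rule isCont_o2[OF _ isCont_signed_powr]) (use params(1) in auto)
  have [measurable]: "signed_powr (1 / \<rho>) \<in> borel_measurable borel"
    using params(1) by (intro borel_measurable_continuous_onI continuous_at_imp_continuous_on)
      (auto intro!: isCont_signed_powr)
  have order_stat_meas: "(\<lambda>\<omega>. order_stat (map (\<theta> k \<omega>) [0..<B k]) (i \<omega>)) \<in> borel_measurable P"
    if "i \<in> measurable P (count_space UNIV)" for k i
    by (rule measurable_compose_countable[OF borel_measurable_order_stat that]) (rule \<theta>_meas)

  \<comment> \<open>A Bahadur representation: near the median, an order statistic depends up to a
    null term only on the number of errors at or below 0. The random index \<open>i\<close> and its
    limit \<open>b\<close> are left open to serve both endpoints.\<close>
  have bahadur: "null_in_probability P (\<lambda>k \<omega>.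
      l k * (order_stat (map (\<theta> k \<omega>) [0..<B k]) (i k \<omega>) - \<theta>\<^sub>0) - signed_powr (1 / \<rho>) (b + G k \<omega> / 2))"
    if i_meas: "\<And>k. i k \<in> measurable P (count_space UNIV)"
      and i_lim: "\<And>\<delta>. 0 < \<delta> \<Longrightarrow> \<forall>\<^sub>F k in sequentially. \<forall>\<omega>\<in>space P.
        \<bar>(2 * real_of_int (i k \<omega>) - real (B k)) / (2 * sqrt (real (B k))) - b\<bar> < \<delta>" for i b
  proof (rule null_in_probability_if_threshold[OF _ _ R_meas params(1) _ R_null i_lim])
    show "(\<lambda>\<omega>. l k * (order_stat (map (\<theta> k \<omega>) [0..<B k]) (i k \<omega>) - \<theta>\<^sub>0)) \<in> borel_measurable P" for k
      by (intro borel_measurable_times borel_measurable_diff borel_measurable_const order_stat_meas i_meas)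
    show "(\<lambda>\<omega>. G k \<omega> / 2) \<in> borel_measurable P" for k by measurable
    show "bounded_in_probability P (\<lambda>k \<omega>. signed_powr (1 / \<rho>) (b + G k \<omega> / 2))"
      by (rule bounded_in_probability_compose[OF G_meas G_bounded signed_powr_cont])
    fix x
    \<comment> \<open>By \<open>i_lim\<close> the deviation \<open>2 * i - B\<close> is at most of
      order \<open>sqrt B\<close>. This bound, with 2 to spare, puts \<open>i\<close> into the range
      from 1 to \<open>B\<close>, where order statistics are meaningful.\<close>
    have "\<forall>\<^sub>F n in sequentially. 2 * sqrt (real n) * (\<bar>b\<bar> + 1) + 2 \<le> real n"
      by real_asymp
    from eventually_compose_filterlim[OF this B_lim] i_lim[OF zero_less_one] B_pos
    show "\<forall>\<^sub>F k in sequentially. \<forall>\<omega>\<in>space P.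
        (l k * (order_stat (map (\<theta> k \<omega>) [0..<B k]) (i k \<omega>) - \<theta>\<^sub>0) \<le> x) \<longleftrightarrow>
        (2 * real_of_int (i k \<omega>) - real (B k)) / (2 * sqrt (real (B k))) + G k \<omega> / 2 \<le> signed_powr \<rho> x + R k x \<omega>"
    proof eventually_elim
      case (elim k)
      define s where "s = sqrt (real (B k))"
      have "0 < s" "real (B k) = s * s" using elim(3) by (simp_all add: s_def)
      have "0 < \<tau> k" using elim(3) params(4)[of k] by (simp add: \<tau>_def)
      show ?case
      proof
        fix \<omega> assume \<omega>: "\<omega> \<in> space P"
        define c where "c = 2 * real_of_int (i k \<omega>) - real (B k)"
        have "\<bar>c / (2 * s) - b\<bar> < 1" using elim(2) \<omega> by (simp add: c_def s_def)
        then have "\<bar>c / (2 * s)\<bar> \<le> \<bar>b\<bar> + 1" by linarith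
        then have "\<bar>c\<bar> \<le> 2 * s * (\<bar>b\<bar> + 1)" using \<open>0 < s\<close> by (simp add: abs_mult field_simps)
        with elim(1) have "\<bar>c\<bar> + 2 \<le> real (B k)" unfolding s_def by linarith
        then have range: "1 \<le> i k \<omega>" "i k \<omega> \<le> int (B k)" unfolding c_def by linarith+
        define T0 Tx where "T0 = (\<Sum>j<B k. indicator {..0} (X k j \<omega>) :: real)"
          and "Tx = (\<Sum>j<B k. indicator {..x * \<tau> k} (X k j \<omega>) :: real)"
        have "(l k * (order_stat (map (\<theta> k \<omega>) [0..<B k]) (i k \<omega>) - \<theta>\<^sub>0) \<le> x) \<longleftrightarrow> real_of_int (i k \<omega>) \<le> Tx"
          unfolding l_def Tx_def X_def
          by (rule scaled_order_stat_le_iff[OF r_pos \<open>0 < \<tau> k\<close> range])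
        \<comment> \<open>Exact algebra: the left side is \<open>(i - T0) / s\<close>, the right
          side \<open>(Tx - T0) / s\<close>, with the limit of the latter added and
          subtracted.\<close>
        also have "\<dots> \<longleftrightarrow> (2 * real_of_int (i k \<omega>) - s * s) / (2 * s) + (s * s - 2 * T0) / s / 2
            \<le> signed_powr \<rho> x + ((Tx - T0) / s - signed_powr \<rho> x)"
          using \<open>0 < s\<close> by (simp add: field_simps)
        also have "\<dots> \<longleftrightarrow> (2 * real_of_int (i k \<omega>) - real (B k)) / (2 * sqrt (real (B k))) + G k \<omega> / 2
            \<le> signed_powr \<rho> x + R k x \<omega>"
          unfolding G_def R_def sum_subtractf T0_def[symmetric] Tx_def[symmetric] s_def[symmetric]
            \<open>real (B k) = s * s\<close> using \<open>0 < s\<close> by simp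
        finally show "(l k * (order_stat (map (\<theta> k \<omega>) [0..<B k]) (i k \<omega>) - \<theta>\<^sub>0) \<le> x) \<longleftrightarrow>
          (2 * real_of_int (i k \<omega>) - real (B k)) / (2 * sqrt (real (B k))) + G k \<omega> / 2 \<le> signed_powr \<rho> x + R k x \<omega>" .
      qed
    qed
  qed

  define c where "c k \<omega> = ghulc_cstar (B k) \<alpha> (U k \<omega>)" for k \<omega>
  define lo where "lo k \<omega> = \<lfloor>real (B k) / 2\<rfloor> - c k \<omega>" for k \<omega>
  define hi where "hi k \<omega> = \<lceil>real (B k) / 2\<rceil> + c k \<omega> + 1" for k \<omega>
  have c_meas [measurable]: "c k \<in> measurable P (count_space UNIV)" for k
  proof -
    note [measurable] = U_meas
    show ?thesis unfolding c_def ghulc_cstar_def by measurable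
  qed
  have lo_meas: "lo k \<in> measurable P (count_space UNIV)"
    and hi_meas: "hi k \<in> measurable P (count_space UNIV)" for k
    unfolding lo_def hi_def by measurable
  have index_lim: "\<forall>\<^sub>F k in sequentially. \<forall>\<omega>\<in>space P.
      \<bar>(2 * real_of_int (lo k \<omega>) - real (B k)) / (2 * sqrt (real (B k))) - (- z / 2)\<bar> < \<delta> \<and>
      \<bar>(2 * real_of_int (hi k \<omega>) - real (B k)) / (2 * sqrt (real (B k))) - z / 2\<bar> < \<delta>"
    if "0 < \<delta>" for \<delta>
  proof -
    define q where "q k = 2 * real_of_int (ghulc_c (B k) \<alpha>) / sqrt (real (B k))" for k
    have "q \<longlonglongrightarrow> z"
      unfolding q_def z_def by (rule filterlim_compose[OF tendsto_ghulc_c[OF alpha] B_lim])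
    from tendstoD[OF this \<open>0 < \<delta>\<close>] have q: "\<forall>\<^sub>F k in sequentially. \<bar>q k - z\<bar> < \<delta>"
      by (simp add: dist_real_def)
    have "\<forall>\<^sub>F n in sequentially. 2 / sqrt (real n) < \<delta> / 2" using \<open>0 < \<delta>\<close> by real_asymp
    from eventually_compose_filterlim[OF this B_lim] q B_pos show ?thesis
    proof eventually_elim
      case (elim k)
      define s where "s = sqrt (real (B k))"
      have "0 < s" using elim(3) by (simp add: s_def)
      define g where "g = real_of_int (ghulc_c (B k) \<alpha>)"
      have q: "q k = 2 * g / s" by (simp add: q_def g_def s_def)
      \<comment> \<open>\<open>e\<close> is -1 for the lower and 1 for the upper index. Rounding of
        \<open>B / 2\<close>, the choice of \<open>c\<close> and the summand 1 together move
        \<open>2 * index - B\<close> by at most 4 from \<open>2 * e * g\<close>, hence the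
        normalised index by at most \<open>2 / s\<close>.\<close>
      have near: "\<bar>y / (2 * s) - x\<bar> < \<delta>" if "\<bar>y - 2 * e * g\<bar> \<le> 4" "\<bar>e * q k / 2 - x\<bar> < \<delta> / 2" for y e x
      proof -
        have "y / (2 * s) - e * q k / 2 = (y - 2 * e * g) / (2 * s)"
          using \<open>0 < s\<close> by (simp add: q field_simps)
        also have "\<bar>\<dots>\<bar> \<le> 4 / (2 * s)"
        proof -
          have "\<bar>y - 2 * e * g\<bar> / (2 * s) \<le> 4 / (2 * s)"
            using that(1) \<open>0 < s\<close> by (intro divide_right_mono) auto
          then show ?thesis using \<open>0 < s\<close> by (simp add: abs_mult)
        qed
        also have "\<dots> < \<delta> / 2" using elim(1) by (simp add: s_def)
        finally show ?thesis using that(2) by linarith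
      qed
      show ?case
      proof (intro ballI conjI)
        fix \<omega> assume "\<omega> \<in> space P"
        have "g - 1 \<le> real_of_int (c k \<omega>)" "real_of_int (c k \<omega>) \<le> g"
          using ghulc_cstar_bounds[where n = "B k" and \<alpha> = \<alpha> and u = "U k \<omega>"]
          unfolding g_def c_def by linarith+
        moreover have "real (B k) / 2 - 1 < \<lfloor>real (B k) / 2\<rfloor>" "\<lfloor>real (B k) / 2\<rfloor> \<le> real (B k) / 2"
            "real (B k) / 2 \<le> \<lceil>real (B k) / 2\<rceil>" "\<lceil>real (B k) / 2\<rceil> < real (B k) / 2 + 1"
          by linarith+
        ultimately have lo_hi: "\<bar>2 * real_of_int (lo k \<omega>) - real (B k) - 2 * (- 1) * g\<bar> \<le> 4"
            "\<bar>2 * real_of_int (hi k \<omega>) - real (B k) - 2 * 1 * g\<bar> \<le> 4"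
          unfolding lo_def hi_def abs_le_iff of_int_diff of_int_add of_int_1 by (simp_all; linarith)+
        have lims: "\<bar>(- 1) * q k / 2 - (- z / 2)\<bar> < \<delta> / 2" "\<bar>1 * q k / 2 - z / 2\<bar> < \<delta> / 2"
          using elim(2) unfolding abs_less_iff by linarith+
        show "\<bar>(2 * real_of_int (lo k \<omega>) - real (B k)) / (2 * sqrt (real (B k))) - (- z / 2)\<bar> < \<delta>"
            "\<bar>(2 * real_of_int (hi k \<omega>) - real (B k)) / (2 * sqrt (real (B k))) - z / 2\<bar> < \<delta>"
          by (fact near[OF lo_hi(1) lims(1), unfolded s_def] near[OF lo_hi(2) lims(2), unfolded s_def])+
      qed
    qed
  qed
  define L where "L k \<omega> = l k * (order_stat (map (\<theta> k \<omega>) [0..<B k]) (lo k \<omega>) - \<theta>\<^sub>0)" for k \<omega>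
  define H where "H k \<omega> = l k * (order_stat (map (\<theta> k \<omega>) [0..<B k]) (hi k \<omega>) - \<theta>\<^sub>0)" for k \<omega>
  have [measurable]: "L k \<in> borel_measurable P" "H k \<in> borel_measurable P" for k
    unfolding L_def H_def
    by (intro borel_measurable_times borel_measurable_diff borel_measurable_const order_stat_meas lo_meas hi_meas)+
  have L_null: "null_in_probability P (\<lambda>k \<omega>. L k \<omega> - signed_powr (1 / \<rho>) (- z / 2 + G k \<omega> / 2))"
    unfolding L_def by (rule bahadur[OF lo_meas]) (use index_lim in \<open>fastforce elim: eventually_mono\<close>)
  have H_null: "null_in_probability P (\<lambda>k \<omega>. H k \<omega> - signed_powr (1 / \<rho>) (z / 2 + G k \<omega> / 2))"
    unfolding H_def by (rule bahadur[OF hi_meas]) (use index_lim in \<open>fastforce elim: eventually_mono\<close>)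

  define V where "V k \<omega> = real (B k) powr (1 / (2 * \<rho>)) * r (N k div B k) * M k powr (1 / \<rho>) *
       width (ghulc_CI A (B k) \<alpha> (\<lambda>i. W i \<omega>) (D k \<omega>) (U k \<omega>))" for k \<omega>
  have CI: "ghulc_CI A (B k) \<alpha> (\<lambda>i. W i \<omega>) (D k \<omega>) (U k \<omega>)
      = {order_stat (map (\<theta> k \<omega>) [0..<B k]) (lo k \<omega>)..order_stat (map (\<theta> k \<omega>) [0..<B k]) (hi k \<omega>)}" for k \<omega>
    by (simp add: ghulc_CI_def Let_def lo_def hi_def c_def \<theta>_def[abs_def])
  have V_meas [measurable]: "V k \<in> borel_measurable P" for k
  proof -
    note [measurable] = order_stat_meas[OF lo_meas] order_stat_meas[OF hi_meas]
    show ?thesis unfolding V_def CI width_Icc by measurable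
  qed
  define g where "g y = limit_fun \<rho> (z / 2 + y / 2) z" for y
  have g: "g y = signed_powr (1 / \<rho>) (z / 2 + y / 2) - signed_powr (1 / \<rho>) (- z / 2 + y / 2)" for y
    by (simp add: g_def limit_fun_eq_signed_powr algebra_simps)
  \<comment> \<open>With endpoints in the wrong order the interval would be empty and its width 0,
    so the indices must be shown to be ordered and in range.\<close>
  have V_eq: "\<forall>\<^sub>F k in sequentially. \<forall>\<omega>\<in>space P. V k \<omega> = H k \<omega> - L k \<omega>"
  proof -
    have "\<forall>\<^sub>F n in sequentially. 2 * sqrt (real n) * (z / 2 + 1) + 2 \<le> real n"
      using \<open>0 < z\<close> by real_asymp
    \<comment> \<open>Accuracy \<open>z / 2\<close> keeps the normalised indices, with limits
      \<open>- z / 2\<close> and \<open>z / 2\<close>, on different sides of 0; accuracy 1 keeps the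
      indices between 1 and \<open>B\<close>.\<close>
    from eventually_compose_filterlim[OF this B_lim] index_lim[OF half_gt_zero[OF \<open>0 < z\<close>]]
      index_lim[OF zero_less_one] B_pos
    show ?thesis
    proof eventually_elim
      case (elim k)
      define s where "s = sqrt (real (B k))"
      have "0 < s" using elim(4) by (simp add: s_def)
      have "0 < M k * s" using \<open>0 < s\<close> params(4)[of k] by simp
      have scale: "real (B k) powr (1 / (2 * \<rho>)) * r (N k div B k) * M k powr (1 / \<rho>) = l k"
      proof -
        have "real (B k) powr (1 / (2 * \<rho>)) = s powr (1 / \<rho>)"
          by (simp add: s_def powr_half_sqrt[symmetric] powr_powr)
        moreover have "1 / \<tau> k = (M k * s) powr (1 / \<rho>)"
          using \<open>0 < M k * s\<close> by (simp add: \<tau>_def s_def powr_minus_divide)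
        moreover have "l k = r (N k div B k) * (1 / \<tau> k)" by (simp add: l_def)
        ultimately show ?thesis
          using \<open>0 < s\<close> params(4)[of k] by (simp add: powr_mult)
      qed
      show ?case
      proof
        fix \<omega> assume \<omega>: "\<omega> \<in> space P"
        define x y where "x = 2 * real_of_int (lo k \<omega>) - real (B k)"
          and "y = 2 * real_of_int (hi k \<omega>) - real (B k)"
        have near: "\<bar>x / (2 * s) - (- z / 2)\<bar> < z / 2" "\<bar>y / (2 * s) - z / 2\<bar> < z / 2"
            "\<bar>x / (2 * s) - (- z / 2)\<bar> < 1" "\<bar>y / (2 * s) - z / 2\<bar> < 1"
          using elim(2,3) \<omega> unfolding x_def y_def s_def by blast+
        from near(1,2) have "x / (2 * s) < y / (2 * s)" by linarith
        then have "x < y" using \<open>0 < s\<close> by (simp add: divide_less_cancel)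
        have "- (z / 2 + 1) \<le> x / (2 * s)" "y / (2 * s) \<le> z / 2 + 1" using near(3,4) by linarith+
        then have "- (2 * s * (z / 2 + 1)) \<le> x" "y \<le> 2 * s * (z / 2 + 1)"
          using \<open>0 < s\<close> by (simp_all add: field_simps)
        with elim(1) \<open>x < y\<close> have range: "1 \<le> lo k \<omega>" "lo k \<omega> \<le> hi k \<omega>" "hi k \<omega> \<le> int (B k)"
          unfolding x_def y_def s_def[symmetric] by linarith+
        then have "order_stat (map (\<theta> k \<omega>) [0..<B k]) (lo k \<omega>) \<le> order_stat (map (\<theta> k \<omega>) [0..<B k]) (hi k \<omega>)"
          by (intro order_stat_mono) auto
        then show "V k \<omega> = H k \<omega> - L k \<omega>"
          unfolding V_def scale CI width_Icc H_def L_def by (simp add: right_diff_distrib)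
      qed
    qed
  qed
  have "null_in_probability P (\<lambda>k \<omega>. V k \<omega> - g (G k \<omega>))"
  proof (rule null_in_probability_cong)
    show "null_in_probability P (\<lambda>k \<omega>. (H k \<omega> - signed_powr (1 / \<rho>) (z / 2 + G k \<omega> / 2))
        - (L k \<omega> - signed_powr (1 / \<rho>) (- z / 2 + G k \<omega> / 2)))"
      by (rule null_in_probability_diff[OF _ _ H_null L_null]) measurable
    show "\<forall>\<^sub>F k in sequentially. \<forall>\<omega>\<in>space P. (H k \<omega> - signed_powr (1 / \<rho>) (z / 2 + G k \<omega> / 2))
        - (L k \<omega> - signed_powr (1 / \<rho>) (- z / 2 + G k \<omega> / 2)) = V k \<omega> - g (G k \<omega>)"
      using V_eq by eventually_elim (simp add: g)
  qed
  moreover have "isCont g y" for y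
    unfolding g[abs_def] by (intro isCont_diff signed_powr_cont)
  ultimately have "weak_conv_m (\<lambda>k. distr P borel (V k)) (distr std_normal_distribution borel g)"
    by (intro weak_conv_continuous_map_perturbed[OF V_meas G_meas G_conv real_dist_normal_dist])
  also have "distr std_normal_distribution borel g
      = distr (distr std_normal_distribution borel (\<lambda>y. z / 2 + 1 / 2 * y)) borel (\<lambda>w. limit_fun \<rho> w z)"
  proof -
    have "(\<lambda>w. limit_fun \<rho> w z) \<in> borel_measurable borel"
      unfolding limit_fun_eq_signed_powr by measurable
    then show ?thesis
      by (subst distr_distr) (auto simp: comp_def g_def[abs_def])
  qed
  also have "distr std_normal_distribution borel (\<lambda>y. z / 2 + 1 / 2 * y)
      = density lborel (normal_density (z / 2) (1 / 2))"
    by (subst distr_std_normal_affine) auto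
  finally show ?thesis unfolding V_def z_def .
qed

end
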